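(* Let $\mathbf n=(n_1,\dots,n_k)\in\mathbb N^k$ and let $\mathcal H$ be a Hilbert space. The following properties hold. (i) The regular polyball $\mathbf B_{\mathbf n}(\mathcal H)$ is relatively open in $B(\mathcal H)^{n_1}\times_c\cdots\times_cB(\mathcal H)^{n_k}$, and its closure in the operator norm topology satisfies $$\mathbf B_{\mathbf n}(\mathcal H)^-=\big\{\mathbf X\in B(\mathcal H)^{n_1}\times_c\cdots\times_cB(\mathcal H)^{n_k}:\ \mathbf\Delta_{\mathbf X}^{\mathbf p}(I)\ge0\ \text{for all }\mathbf p=(p_1,\dots,p_k)\text{ with }p_i\in\{0,1\}\big\},$$ where $\mathbf\Delta_{\mathbf X}^{\mathbf p}:=(id-\Phi_{X_1})^{p_1}\circ\cdots\circ(id-\Phi_{X_k})^{p_k}$ and $(id-\Phi_{X_i})^0:=id$. (ii) $\mathbf B_{\mathbf n}(\mathcal H)$ is a complete Reinhardt domain such that $$\mathbf B_{\mathbf n}(\mathcal H)=\bigcup_{\mathbf z\in\overline{\mathbb D}^{n_1+\cdots+n_k}}\mathbf z\mathbf B_{\mathbf n}(\mathcal H)=\bigcup_{\mathbf z\in\mathbb D^{n_1+\cdots+n_k}}\mathbf z\mathbf B_{\mathbf n}(\mathcal H)^-=\bigcup_{\mathbf z\in\mathbb D^{n_1+\cdots+n_k}}\mathbf z\mathbf B_{\mathbf n}(\mathcal H)$$ and $$\mathbf B_{\mathbf n}(\mathcal H)=\bigcup_{0\le r<1}r\mathbf B_{\mathbf n}(\mathcal H)=\bigcup_{0\le r<1}r\mathbf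 B_{\mathbf n}(\mathcal H)^-.$$ (iii) $\mathbf B_{\mathbf n}(\mathcal H)^-$ is a complete Reinhardt set and $$\mathbf B_{\mathbf n}(\mathcal H)^-=\bigcup_{\mathbf z\in\overline{\mathbb D}^{n_1+\cdots+n_k}}\mathbf z\mathbf B_{\mathbf n}(\mathcal H)^-=\bigcup_{0\le r\le1}r\mathbf B_{\mathbf n}(\mathcal H)^-.$$
   Context: **Polyball.** For a complex Hilbert space $\mathcal H$, $B(\mathcal H)^{n_1}\times_c\cdots\times_c B(\mathcal H)^{n_k}$ is the set of tuples $\mathbf X=(X_1,\dots,X_k)$, $X_i=(X_{i,1},\dots,X_{i,n_i})\in B(\mathcal H)^{n_i}$, such that each entry of $X_s$ commutes with each entry of $X_t$ whenever $s\neq t$ (entries of a single $X_s$ need not commute). Put $\Phi_{X_i}(Y)=\sum_{j=1}^{n_i}X_{i,j}YX_{i,j}^*$ and $\mathbf\Delta_{\mathbf X}=(id-\Phi_{X_1})\circ\cdots\circ(id-\Phi_{X_k})$ on $B(\mathcal H)$. The regular polyball $\mathbf B_{\mathbf n}(\mathcal H)$ is the set of all such $\mathbf X$ with $\|\sum_jX_{i,j}X_{i,j}^*\|<1$ for each $i$ and $\mathbf\Delta_{\mathbf X}(I)>0$ (positive and invertible). **Reinhardt sets.** $\mathbb D$ is the open unit disc of $\mathbb C$. For $\mathbf z=(z_{i,j})\in\mathbb C^{n_1+\cdots+n_k}$, $\mathbf z\mathbf X$ is the tuple with entries $z_{i,j}X_{i,j}$; $\mathbf zG=\{\mathbf z\mathbf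 X:\mathbf X\in G\}$. A subset $G\subset B(\mathcal H)^{n_1}\times\cdots\times B(\mathcal H)^{n_k}$ is a complete Reinhardt set if $\mathbf z\mathbf X\in G$ for all $\mathbf X\in G$ and $\mathbf z\in\overline{\mathbb D}^{n_1+\cdots+n_k}$. *)

theory Defs
  imports "HOL-Analysis.Analysis"
begin

section \<open>Complex Hilbert spaces and their bounded operators\<close>

text \<open>The complex inner product is linear in its first argument; the norm and the topology are
  those of the underlying real Hilbert space, whose inner product is the real part of the complex
  one.\<close>

class complex_hilbert_space = real_inner + complete_space +
  fixes scaleC :: "complex \<Rightarrow> 'a \<Rightarrow> 'a" (infixr "*\<^sub>C" 75)
    and cinner :: "'a \<Rightarrow> 'a \<Rightarrow> complex"
  assumes scaleC_add_right: "c *\<^sub>C (x + y) = c *\<^sub>C x + c *\<^sub>C y"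
    and scaleC_add_left: "(c + d) *\<^sub>C x = c *\<^sub>C x + d *\<^sub>C x"
    and scaleC_scaleC: "c *\<^sub>C (d *\<^sub>C x) = (c * d) *\<^sub>C x"
    and scaleR_scaleC: "r *\<^sub>R x = complex_of_real r *\<^sub>C x"
    and cinner_add_left: "cinner (x + y) z = cinner x z + cinner y z"
    and cinner_scaleC_left: "cinner (c *\<^sub>C x) y = c * cinner x y"
    and cinner_commute: "cinner x y = cnj (cinner y x)"
    and inner_eq_Re_cinner: "inner x y = Re (cinner x y)"

lemma norm_scaleC:
  fixes x :: "'h::complex_hilbert_space"
  shows "norm (c *\<^sub>C x) = cmod c * norm x"
proof -
  have "cinner x (c *\<^sub>C x) = cnj c * cinner x x"
    by (subst (1 2) cinner_commute) (simp add: cinner_scaleC_left)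
  then have "cinner (c *\<^sub>C x) (c *\<^sub>C x) = c * cnj c * cinner x x"
    by (simp add: cinner_scaleC_left)
  also have "\<dots> = complex_of_real ((cmod c)\<^sup>2) * cinner x x"
    by (simp only: complex_norm_square)
  finally have "inner (c *\<^sub>C x) (c *\<^sub>C x) = (cmod c)\<^sup>2 * inner x x"
    by (simp add: inner_eq_Re_cinner flip: of_real_power)
  then show ?thesis
    by (simp add: norm_eq_sqrt_inner real_sqrt_mult)
qed

text \<open>$B(\mathcal H)$ is the set of complex-linear elements of the type of bounded real-linear
  operators; the norm of that type is the operator norm.\<close>

definition bounded_ops :: "('h::complex_hilbert_space \<Rightarrow>\<^sub>L 'h) set" where
  "bounded_ops = {T. \<forall>c x. blinfun_apply T (c *\<^sub>C x) = c *\<^sub>C blinfun_apply T x}"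

lift_definition scaleC_op :: "complex \<Rightarrow> ('h::complex_hilbert_space \<Rightarrow>\<^sub>L 'h) \<Rightarrow> ('h \<Rightarrow>\<^sub>L 'h)"
  is "\<lambda>c T x. c *\<^sub>C T x"
proof -
  fix c :: complex and T :: "'h \<Rightarrow> 'h"
  assume T: "bounded_linear T"
  have comm: "c *\<^sub>C (r *\<^sub>R x) = r *\<^sub>R (c *\<^sub>C x)" for r and x :: 'h
    by (simp add: scaleR_scaleC scaleC_scaleC mult.commute)
  have "bounded_linear (\<lambda>x::'h. c *\<^sub>C x)"
    by (rule bounded_linear_intro[where K = "cmod c"])
      (simp_all add: scaleC_add_right comm norm_scaleC mult.commute)
  from bounded_linear_compose[OF this T] show "bounded_linear (\<lambda>x. c *\<^sub>C T x)" .
qed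

definition adj_op :: "('h::complex_hilbert_space \<Rightarrow>\<^sub>L 'h) \<Rightarrow> ('h \<Rightarrow>\<^sub>L 'h)" where
  "adj_op T = (THE S. S \<in> bounded_ops \<and>
     (\<forall>x y. cinner (blinfun_apply T x) y = cinner x (blinfun_apply S y)))"

definition nonneg_op :: "('h::complex_hilbert_space \<Rightarrow>\<^sub>L 'h) \<Rightarrow> bool" where
  "nonneg_op T \<longleftrightarrow> T \<in> bounded_ops \<and>
     (\<forall>x. cinner (blinfun_apply T x) x \<in> \<real> \<and> 0 \<le> Re (cinner (blinfun_apply T x) x))"

definition invertible_op :: "('h::complex_hilbert_space \<Rightarrow>\<^sub>L 'h) \<Rightarrow> bool" where
  "invertible_op T \<longleftrightarrow> T \<in> bounded_ops \<and>
     (\<exists>S\<in>bounded_ops. S o\<^sub>L T = id_blinfun \<and> T o\<^sub>L S = id_blinfun)"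

definition pos_op :: "('h::complex_hilbert_space \<Rightarrow>\<^sub>L 'h) \<Rightarrow> bool" where
  "pos_op T \<longleftrightarrow> nonneg_op T \<and> invertible_op T"


section \<open>Tuples of operators\<close>

text \<open>The $i$-th block has \<open>n i\<close> entries; both indices are counted from 0, so the entry
  $X_{i,j}$ is \<open>X (i - 1, j - 1)\<close>. Tuples are extensional functions on the index set.\<close>

type_synonym 'h op_tuple = "nat \<times> nat \<Rightarrow> ('h \<Rightarrow>\<^sub>L 'h)"

definition idx :: "nat \<Rightarrow> (nat \<Rightarrow> nat) \<Rightarrow> (nat \<times> nat) set" where
  "idx k n = (SIGMA i:{..<k}. {..<n i})"

definition op_tuples :: "nat \<Rightarrow> (nat \<Rightarrow> nat) \<Rightarrow> 'h::complex_hilbert_space op_tuple set" where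
  "op_tuples k n = idx k n \<rightarrow>\<^sub>E bounded_ops"

text \<open>The operator norm topology on tuples is the product of the norm topologies of the entries.\<close>

definition op_topology :: "nat \<Rightarrow> (nat \<Rightarrow> nat) \<Rightarrow> 'h::complex_hilbert_space op_tuple topology" where
  "op_topology k n = product_topology (\<lambda>_. top_of_set bounded_ops) (idx k n)"

definition commuting_tuples :: "nat \<Rightarrow> (nat \<Rightarrow> nat) \<Rightarrow> 'h::complex_hilbert_space op_tuple set" where
  "commuting_tuples k n = {X \<in> op_tuples k n.
     \<forall>s<k. \<forall>t<k. s \<noteq> t \<longrightarrow>
       (\<forall>i<n s. \<forall>j<n t. X (s, i) o\<^sub>L X (t, j) = X (t, j) o\<^sub>L X (s, i))}"

definition Phi :: "(nat \<Rightarrow> nat) \<Rightarrow> 'h::complex_hilbert_space op_tuple \<Rightarrow> nat \<Rightarrow> ('h \<Rightarrow>\<^sub>L 'h) \<Rightarrow> ('h \<Rightarrow>\<^sub>L 'h)" where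
  "Phi n X i Y = (\<Sum>j<n i. X (i, j) o\<^sub>L Y o\<^sub>L adj_op (X (i, j)))"

definition defect_map ::
  "nat \<Rightarrow> (nat \<Rightarrow> nat) \<Rightarrow> 'h::complex_hilbert_space op_tuple \<Rightarrow> ('h \<Rightarrow>\<^sub>L 'h) \<Rightarrow> ('h \<Rightarrow>\<^sub>L 'h)" where
  "defect_map k n X = foldr (\<circ>) (map (\<lambda>i Y. Y - Phi n X i Y) [0..<k]) id"

definition defect_map_pow ::
  "nat \<Rightarrow> (nat \<Rightarrow> nat) \<Rightarrow> (nat \<Rightarrow> nat) \<Rightarrow> 'h::complex_hilbert_space op_tuple \<Rightarrow> ('h \<Rightarrow>\<^sub>L 'h) \<Rightarrow> ('h \<Rightarrow>\<^sub>L 'h)" where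
  "defect_map_pow k n p X = foldr (\<circ>) (map (\<lambda>i. (\<lambda>Y. Y - Phi n X i Y) ^^ p i) [0..<k]) id"


section \<open>The regular polyball and Reinhardt sets\<close>

definition polyball :: "nat \<Rightarrow> (nat \<Rightarrow> nat) \<Rightarrow> 'h::complex_hilbert_space op_tuple set" where
  "polyball k n = {X \<in> commuting_tuples k n.
     (\<forall>i<k. norm (\<Sum>j<n i. X (i, j) o\<^sub>L adj_op (X (i, j))) < 1) \<and>
     pos_op (defect_map k n X id_blinfun)}"

definition scale_tuple ::
  "nat \<Rightarrow> (nat \<Rightarrow> nat) \<Rightarrow> (nat \<times> nat \<Rightarrow> complex) \<Rightarrow> 'h::complex_hilbert_space op_tuple \<Rightarrow> 'h op_tuple" where
  "scale_tuple k n z X = (\<lambda>ij\<in>idx k n. scaleC_op (z ij) (X ij))"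

definition scaleR_tuple ::
  "nat \<Rightarrow> (nat \<Rightarrow> nat) \<Rightarrow> real \<Rightarrow> 'h::complex_hilbert_space op_tuple \<Rightarrow> 'h op_tuple" where
  "scaleR_tuple k n r X = (\<lambda>ij\<in>idx k n. r *\<^sub>R X ij)"

definition polydisc :: "nat \<Rightarrow> (nat \<Rightarrow> nat) \<Rightarrow> (nat \<times> nat \<Rightarrow> complex) set" where
  "polydisc k n = idx k n \<rightarrow>\<^sub>E ball 0 1"

definition closed_polydisc :: "nat \<Rightarrow> (nat \<Rightarrow> nat) \<Rightarrow> (nat \<times> nat \<Rightarrow> complex) set" where
  "closed_polydisc k n = idx k n \<rightarrow>\<^sub>E cball 0 1"

definition complete_reinhardt_set ::
  "nat \<Rightarrow> (nat \<Rightarrow> nat) \<Rightarrow> 'h::complex_hilbert_space op_tuple set \<Rightarrow> bool" where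
  "complete_reinhardt_set k n G \<longleftrightarrow> G \<subseteq> op_tuples k n \<and>
     (\<forall>X\<in>G. \<forall>z\<in>closed_polydisc k n. scale_tuple k n z X \<in> G)"

text \<open>As in several complex variables, a domain is a nonempty connected open set; openness is
  relative to the commuting tuples.\<close>

definition complete_reinhardt_domain ::
  "nat \<Rightarrow> (nat \<Rightarrow> nat) \<Rightarrow> 'h::complex_hilbert_space op_tuple set \<Rightarrow> bool" where
  "complete_reinhardt_domain k n G \<longleftrightarrow> complete_reinhardt_set k n G \<and> G \<noteq> {} \<and>
     openin (subtopology (op_topology k n) (commuting_tuples k n)) G \<and>
     connectedin (op_topology k n) G"

end

theory Submission
  imports Defs
begin

text \<open>For \<open>S \<subseteq> {..<k}\<close> let \<open>\<Delta>\<^sub>X\<^sup>S\<close> be the composition of the maps \<open>id - \<Phi>\<^sub>i\<close> with \<open>i \<in> S\<close>, and let \<open>C\<close>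
  be the set of commuting tuples with \<open>\<Delta>\<^sub>X\<^sup>S(I) \<ge> 0\<close> for all \<open>S\<close>. The maps \<open>\<Phi>\<^sub>i\<close> commute with each other,
  so \<open>\<Delta>\<^sub>X\<^sup>S\<close> is well defined and any factor can be split off. The whole proposition follows from
  three facts about \<open>C\<close> and the polyball \<open>B\<close>.

  First, \<open>B \<subseteq> C\<close> (\<open>polyball_subset_nonneg_defect_tuples\<close>). If \<open>\<parallel>\<Phi>\<^sub>i(I)\<parallel> < 1\<close>, then \<open>Y - \<Phi>\<^sub>i(Y) \<ge> 0\<close>
  implies \<open>Y \<ge> 0\<close>, so factors can be removed from \<open>\<Delta>\<^sub>X(I) \<ge> 0\<close> one at a time.

  Second, strict scaling maps \<open>C\<close> into \<open>B\<close> (\<open>scale_all_blocks\<close>, \<open>scale_tuple_in_polyball\<close>). If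
  \<open>\<bar>z\<^sub>i\<^sub>j\<bar>\<^sup>2 \<le> q \<le> 1\<close>, then scaling one block replaces \<open>\<Phi>\<^sub>i\<close> by a map \<open>\<Phi>\<^sub>i'\<close> with \<open>\<Phi>\<^sub>i' \<le> q \<Phi>\<^sub>i\<close> on
  nonnegative operators, whence \<open>Y - \<Phi>\<^sub>i'(Y) \<ge> (1 - q) Y + q (Y - \<Phi>\<^sub>i(Y))\<close>. Doing this for all blocks
  stays inside \<open>C\<close> and gives \<open>\<Delta>(I) \<ge> (1 - q)\<^sup>k I\<close> for the scaled tuple, which is strictly positive
  when \<open>q < 1\<close>.

  Third, \<open>B\<close> is open in the commuting tuples and \<open>C\<close> is closed, because \<open>\<Delta>\<^sub>X\<^sup>S(I)\<close> depends
  continuously on \<open>X\<close> in norm, positive invertibility is an open condition and nonnegativity a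
  closed one.

  The closure of \<open>B\<close> is then \<open>C\<close>, since \<open>X \<in> C\<close> is the limit of \<open>rX \<in> B\<close> as \<open>r\<close> increases to 1.
  Openness gives \<open>tX \<in> B\<close> for some \<open>t > 1\<close> whenever \<open>X \<in> B\<close>, and hence \<open>B\<close> is the union of the sets
  \<open>rB\<close> with \<open>r < 1\<close>. All the other unions are sandwiched between these inclusions.

  Adjoints and the inverses of strictly positive operators are obtained from one variational
  lemma, \<open>coercive_represents_functional\<close>.\<close>

section \<open>Adjoints and invertibility by minimising a quadratic functional\<close>

lemma quadratic_nonneg_linear_coeff_0:
  fixes a b :: real
  assumes "\<And>t. 0 \<le> 2 * t * b + t\<^sup>2 * a" and "0 \<le> a"
  shows "b = 0"
proof (rule ccontr)
  assume "b \<noteq> 0"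
  have "2 * (- b / (a + 1)) * b + (- b / (a + 1))\<^sup>2 * a = - (b\<^sup>2 * (a + 2)) / (a + 1)\<^sup>2"
    using assms(2) by (simp add: divide_simps power2_eq_square) (simp add: algebra_simps)
  also have "\<dots> < 0"
    using \<open>b \<noteq> 0\<close> assms(2) by (simp add: divide_simps)
  finally show False
    using assms(1)[of "- b / (a + 1)"] by simp
qed

text \<open>The vector is the minimiser of the strictly convex functional
  \<open>J x = \<langle>Tx, x\<rangle> - 2 f x\<close>: minimising sequences are Cauchy by the parallelogram law, and the
  directional derivatives of \<open>J\<close> vanish at the minimiser. For \<open>T = id\<close> this is the Riesz
  representation theorem; for \<open>f = \<langle>y, \<cdot>\<rangle>\<close> it solves \<open>Tv = y\<close>.\<close>

lemma coercive_represents_functional: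
  fixes T :: "'a::{real_inner,complete_space} \<Rightarrow>\<^sub>L 'a"
  assumes sym: "\<And>x y. inner (T x) y = inner x (T y)"
    and "c > 0" and coercive: "\<And>x. c * (norm x)\<^sup>2 \<le> inner (T x) x"
    and f: "bounded_linear f"
  obtains v where "\<And>x. inner (T v) x = f x"
proof -
  interpret f: bounded_linear f by (rule f)
  define J where "J x = inner (T x) x - 2 * f x" for x
  obtain K where K: "\<And>x. norm (f x) \<le> norm x * K" using f.bounded by blast
  have J_lower: "- (K\<^sup>2 / c) \<le> J x" for x
  proof -
    have "0 \<le> (c * norm x - K)\<^sup>2" by simp
    then have "- (K\<^sup>2) \<le> c * (c * (norm x)\<^sup>2 - 2 * (norm x * K))"
      by (simp add: power2_eq_square algebra_simps)
    then have "- (K\<^sup>2 / c) \<le> c * (norm x)\<^sup>2 - 2 * (norm x * K)"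
      using \<open>c > 0\<close> by (simp add: field_simps)
    then show ?thesis
      using K[of x] coercive[of x] by (simp add: J_def abs_if split: if_splits)
  qed
  define m where "m = Inf (range J)"
  have bdd: "bdd_below (range J)" using J_lower by (auto intro!: bdd_belowI)
  have m_le: "m \<le> J x" for x unfolding m_def by (rule cInf_lower[OF _ bdd]) simp
  have "\<exists>x. J x < m + 1 / real (Suc i)" for i
    using cInf_less_iff[OF _ bdd, of "m + 1 / real (Suc i)"] by (auto simp: m_def)
  then obtain u where u: "\<And>i. J (u i) < m + 1 / real (Suc i)" by metis
  have parallelogram: "c * (norm (x - y))\<^sup>2 \<le> 2 * (J x - m) + 2 * (J y - m)" for x y
  proof -
    have "2 * J x + 2 * J y - 4 * J ((1/2) *\<^sub>R (x + y)) = inner (T (x - y)) (x - y)"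
      by (simp add: J_def f.add f.scaleR f.diff blinfun.bilinear_simps inner_simps
          add_divide_distrib diff_divide_distrib algebra_simps)
    then show ?thesis using m_le[of "(1/2) *\<^sub>R (x + y)"] coercive[of "x - y"] by simp
  qed
  have "Cauchy u"
  proof (rule metric_CauchyI)
    fix e :: real assume "e > 0"
    define d where "d = c * e\<^sup>2 / 4"
    have "d > 0" using \<open>c > 0\<close> \<open>e > 0\<close> by (simp add: d_def)
    then obtain N where N: "1 / real (Suc N) < d"
      using nat_approx_posE by blast
    have close: "J (u i) < m + d" if "i \<ge> N" for i
    proof -
      have "1 / real (Suc i) \<le> 1 / real (Suc N)" using that by (simp add: frac_le)
      then show ?thesis using u[of i] N by linarith
    qed
    have "dist (u i) (u j) < e" if "i \<ge> N" "j \<ge> N" for i j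
    proof -
      have "c * (norm (u i - u j))\<^sup>2 < 4 * d"
        using parallelogram[of "u i" "u j"] close[OF that(1)] close[OF that(2)] by argo
      also have "4 * d = c * e\<^sup>2" by (simp add: d_def)
      finally have "c * (norm (u i - u j))\<^sup>2 < c * e\<^sup>2" .
      then have "(norm (u i - u j))\<^sup>2 < e\<^sup>2" using \<open>c > 0\<close> by simp
      then show ?thesis using \<open>e > 0\<close> by (simp add: dist_norm power_less_imp_less_base)
    qed
    then show "\<exists>N. \<forall>i\<ge>N. \<forall>j\<ge>N. dist (u i) (u j) < e" by blast
  qed
  then obtain v where v: "u \<longlonglongrightarrow> v" using Cauchy_convergent_iff convergent_def by blast
  have "(\<lambda>i. J (u i)) \<longlonglongrightarrow> J v"
    unfolding J_def by (intro tendsto_intros f.tendsto v)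
  moreover have "(\<lambda>i. m + 1 / real (Suc i)) \<longlonglongrightarrow> m + 0"
    by (intro tendsto_intros LIMSEQ_Suc[OF lim_1_over_n])
  ultimately have "J v \<le> m + 0"
    by (rule LIMSEQ_le) (use u less_imp_le in blast)
  then have minimal: "J v \<le> J x" for x using m_le[of x] by simp
  have "inner (T v) x - f x = 0" for x
  proof (rule quadratic_nonneg_linear_coeff_0)
    fix t :: real
    have "J (v + t *\<^sub>R x) - J v = 2 * t * (inner (T v) x - f x) + t\<^sup>2 * inner (T x) x"
      using sym[of x v]
      by (simp add: J_def f.add f.scaleR blinfun.bilinear_simps inner_simps
          inner_commute power2_eq_square algebra_simps)
    then show "0 \<le> 2 * t * (inner (T v) x - f x) + t\<^sup>2 * inner (T x) x"
      using minimal[of "v + t *\<^sub>R x"] by simp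
  next
    show "0 \<le> inner (T x) x"
      by (rule order_trans[OF _ coercive]) (use \<open>c > 0\<close> in simp)
  qed
  then show thesis by (intro that[of v]) simp
qed

lemma cinner_scaleC_right:
  fixes x y :: "'h::complex_hilbert_space"
  shows "cinner x (c *\<^sub>C y) = cnj c * cinner x y"
  by (subst (1 2) cinner_commute) (simp add: cinner_scaleC_left)

lemma cinner_eq_Complex_inner:
  fixes x y :: "'h::complex_hilbert_space"
  shows "cinner x y = Complex (inner x y) (- inner (\<i> *\<^sub>C x) y)"
  by (simp add: complex_eq_iff inner_eq_Re_cinner cinner_scaleC_left)

lemma scaleC_diff_right:
  fixes x y :: "'h::complex_hilbert_space"
  shows "c *\<^sub>C (x - y) = c *\<^sub>C x - c *\<^sub>C y"
  using scaleC_add_right[of c "x - y" y] by simp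

lemma scaleC_zero_right [simp]: "c *\<^sub>C (0::'h::complex_hilbert_space) = 0"
  using scaleC_diff_right[of c "0::'h" 0] by simp

lemma scaleC_op_apply [simp]: "blinfun_apply (scaleC_op c T) x = c *\<^sub>C T x"
  by transfer simp

lemma scaleC_op_of_real:
  fixes T :: "'h::complex_hilbert_space \<Rightarrow>\<^sub>L 'h"
  shows "scaleC_op (complex_of_real r) T = r *\<^sub>R T"
  by (rule blinfun_eqI) (simp add: blinfun.scaleR_left scaleR_scaleC)

lemma scaleC_op_1 [simp]: "scaleC_op 1 T = (T :: 'h::complex_hilbert_space \<Rightarrow>\<^sub>L 'h)"
  using scaleC_op_of_real[of 1 T] by simp

lemma scaleC_op_scaleC_op: "scaleC_op c (scaleC_op d T) = scaleC_op (c * d) T"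
  by (rule blinfun_eqI) (simp add: scaleC_scaleC)

lemma bounded_opsD: "T \<in> bounded_ops \<Longrightarrow> blinfun_apply T (c *\<^sub>C x) = c *\<^sub>C blinfun_apply T x"
  by (simp add: bounded_ops_def)

lemma zero_in_bounded_ops [simp]: "0 \<in> bounded_ops"
  by (simp add: bounded_ops_def)

lemma id_in_bounded_ops [simp]: "id_blinfun \<in> bounded_ops"
  by (simp add: bounded_ops_def)

lemma bounded_ops_add: "S \<in> bounded_ops \<Longrightarrow> T \<in> bounded_ops \<Longrightarrow> S + T \<in> bounded_ops"
  by (simp add: bounded_ops_def blinfun.add_left scaleC_add_right)

lemma bounded_ops_diff: "S \<in> bounded_ops \<Longrightarrow> T \<in> bounded_ops \<Longrightarrow> S - T \<in> bounded_ops"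
  by (simp add: bounded_ops_def blinfun.diff_left scaleC_diff_right)

lemma bounded_ops_sum: "(\<And>j. j \<in> A \<Longrightarrow> T j \<in> bounded_ops) \<Longrightarrow> (\<Sum>j\<in>A. T j) \<in> bounded_ops"
  by (induction A rule: infinite_finite_induct) (auto intro: bounded_ops_add)

lemma bounded_ops_compose: "S \<in> bounded_ops \<Longrightarrow> T \<in> bounded_ops \<Longrightarrow> S o\<^sub>L T \<in> bounded_ops"
  by (simp add: bounded_ops_def)

lemma bounded_ops_scaleC: "T \<in> bounded_ops \<Longrightarrow> scaleC_op c T \<in> bounded_ops"
  by (simp add: bounded_ops_def scaleC_scaleC mult.commute)

text \<open>The real Riesz theorem produces \<open>S y\<close> from the functional \<open>x \<mapsto> \<langle>Tx, y\<rangle>\<close>; complex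
  linearity of \<open>T\<close> upgrades the identity of real inner products to one of complex ones.\<close>

lemma adjoint_exists:
  fixes T :: "'h::complex_hilbert_space \<Rightarrow>\<^sub>L 'h"
  assumes T: "T \<in> bounded_ops"
  obtains S where "S \<in> bounded_ops" "\<And>x y. cinner (T x) y = cinner x (blinfun_apply S y)"
proof -
  have "\<exists>v. \<forall>x. inner v x = inner (T x) y" for y
    by (rule coercive_represents_functional[of "id_blinfun :: 'h \<Rightarrow>\<^sub>L 'h" 1 "\<lambda>x. inner (T x) y"])
      (auto simp: power2_norm_eq_inner
        intro: bounded_linear_compose[OF bounded_linear_inner_left blinfun.bounded_linear_right])
  then obtain s where s: "\<And>x y. inner (s y) x = inner (T x) y" by metis
  have "cinner (T x) y = cinner x (s y)" for x y
  proof -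
    have "inner (T x) y = inner x (s y)" for x using s[of y x] by (simp add: inner_commute)
    then show ?thesis
      by (simp add: cinner_eq_Complex_inner flip: bounded_opsD[OF T])
  qed
  note cs = this
  have eqI: "a = b" if "\<And>x. inner a x = inner b x" for a b :: 'h
    using that[of "a - b"] by (metis inner_diff_left eq_iff_diff_eq_0 inner_eq_zero_iff)
  have "bounded_linear s"
  proof (rule bounded_linear_intro[where K = "norm T"])
    fix y
    have "norm (s y) * norm (s y) = inner (T (s y)) y"
      using s[of y "s y"] by (simp add: power2_norm_eq_inner flip: power2_eq_square)
    also have "\<dots> \<le> norm (T (s y)) * norm y" by (rule norm_cauchy_schwarz)
    also have "\<dots> \<le> (norm T * norm (s y)) * norm y"
      by (intro mult_right_mono norm_blinfun) simp
    finally have "norm (s y) * norm (s y) \<le> norm (s y) * (norm y * norm T)"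
      by (simp add: ac_simps)
    then show "norm (s y) \<le> norm y * norm T"
      by (cases "s y = 0") auto
  qed (auto intro!: eqI simp: s inner_simps)
  then have app: "blinfun_apply (Blinfun s) = s" by (rule bounded_linear_Blinfun_apply)
  show thesis
  proof
    show "cinner (T x) y = cinner x (Blinfun s y)" for x y by (simp add: cs app)
    have "s (c *\<^sub>C y) = c *\<^sub>C s y" for c y
    proof (rule eqI)
      fix x
      have "cinner x (s (c *\<^sub>C y)) = cinner x (c *\<^sub>C s y)"
        by (simp add: cinner_scaleC_right flip: cs)
      then show "inner (s (c *\<^sub>C y)) x = inner (c *\<^sub>C s y) x"
        by (metis inner_commute inner_eq_Re_cinner)
    qed
    then show "Blinfun s \<in> bounded_ops" by (simp add: bounded_ops_def app)
  qed
qed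

lemma blinfun_eqI_inner:
  fixes S T :: "'a::real_inner \<Rightarrow>\<^sub>L 'a"
  assumes "\<And>x y. inner x (S y) = inner x (T y)"
  shows "S = T"
proof (rule blinfun_eqI)
  fix y
  have "inner (S y - T y) (S y - T y) = 0" by (simp only: inner_diff_right assms)
  then show "S y = T y" by simp
qed

lemma
  assumes T: "T \<in> bounded_ops"
  shows adj_op_in_bounded_ops: "adj_op T \<in> bounded_ops"
    and cinner_adj_op: "cinner (blinfun_apply T x) y = cinner x (adj_op T y)"
proof -
  obtain S where S: "S \<in> bounded_ops" "\<And>x y. cinner (blinfun_apply T x) y = cinner x (blinfun_apply S y)"
    using adjoint_exists[OF T] by blast
  have "S' = S" if "\<forall>x y. cinner (blinfun_apply T x) y = cinner x (blinfun_apply S' y)" for S'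
  proof (rule blinfun_eqI_inner)
    show "inner x (blinfun_apply S' y) = inner x (blinfun_apply S y)" for x y
      by (metis that S(2) inner_eq_Re_cinner)
  qed
  with S have "adj_op T \<in> bounded_ops \<and> (\<forall>x y. cinner (blinfun_apply T x) y = cinner x (adj_op T y))"
    unfolding adj_op_def
    by (intro theI[of "\<lambda>S. S \<in> bounded_ops \<and> (\<forall>x y. cinner (blinfun_apply T x) y = cinner x (blinfun_apply S y))" S])
      blast+
  then show "adj_op T \<in> bounded_ops" "cinner (blinfun_apply T x) y = cinner x (adj_op T y)" by auto
qed

lemma inner_adj_op:
  assumes "T \<in> bounded_ops"
  shows "inner (blinfun_apply T x) y = inner x (adj_op T y)"
    and "inner (adj_op T y) x = inner y (blinfun_apply T x)"
proof -
  show *: "inner (blinfun_apply T x) y = inner x (adj_op T y)" for x y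
    by (simp add: inner_eq_Re_cinner cinner_adj_op[OF assms])
  show "inner (adj_op T y) x = inner y (blinfun_apply T x)"
    using *[of x y] by (simp add: inner_commute)
qed

lemma adj_op_eqI:
  assumes "T \<in> bounded_ops" and "\<And>x y. inner (blinfun_apply T x) y = inner x (blinfun_apply S y)"
  shows "adj_op T = S"
  by (rule blinfun_eqI_inner) (simp add: assms flip: inner_adj_op(1)[OF assms(1)])

lemma adj_op_diff:
  assumes "S \<in> bounded_ops" "T \<in> bounded_ops"
  shows "adj_op (S - T) = adj_op S - adj_op T"
  by (rule adj_op_eqI[OF bounded_ops_diff[OF assms]])
    (simp add: blinfun.diff_left inner_diff_left inner_diff_right inner_adj_op(1) assms)

lemma adj_op_compose:
  assumes "S \<in> bounded_ops" "T \<in> bounded_ops"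
  shows "adj_op (S o\<^sub>L T) = adj_op T o\<^sub>L adj_op S"
  by (rule adj_op_eqI[OF bounded_ops_compose[OF assms]]) (simp add: inner_adj_op(1) assms)

lemma adj_op_scaleC:
  assumes "T \<in> bounded_ops"
  shows "adj_op (scaleC_op c T) = scaleC_op (cnj c) (adj_op T)"
  by (rule adj_op_eqI[OF bounded_ops_scaleC[OF assms]])
    (simp add: inner_eq_Re_cinner cinner_scaleC_left cinner_scaleC_right cinner_adj_op[OF assms])

lemma norm_adj_op_le:
  assumes T: "T \<in> bounded_ops"
  shows "norm (adj_op T) \<le> norm T"
proof (rule norm_blinfun_bound)
  fix y
  have "norm (adj_op T y) * norm (adj_op T y) = inner (T (adj_op T y)) y"
    by (simp add: inner_adj_op(1)[OF T] power2_norm_eq_inner flip: power2_eq_square)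
  also have "\<dots> \<le> norm (T (adj_op T y)) * norm y" by (rule norm_cauchy_schwarz)
  also have "\<dots> \<le> (norm T * norm (adj_op T y)) * norm y"
    by (intro mult_right_mono norm_blinfun) simp
  finally have "norm (adj_op T y) * norm (adj_op T y) \<le> norm (adj_op T y) * (norm T * norm y)"
    by (simp add: ac_simps)
  then show "norm (adj_op T y) \<le> norm T * norm y"
    by (cases "adj_op T y = 0") auto
qed simp

lemma continuous_on_adj_op: "continuous_on bounded_ops adj_op"
proof (rule continuous_onI)
  fix T :: "'h::complex_hilbert_space \<Rightarrow>\<^sub>L 'h" and e :: real
  assume "T \<in> bounded_ops" "e > 0"
  then have "dist (adj_op S) (adj_op T) \<le> dist S T" if "S \<in> bounded_ops" for S
    using norm_adj_op_le[OF bounded_ops_diff[OF that \<open>T \<in> bounded_ops\<close>]] that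
    by (simp add: dist_norm adj_op_diff)
  then show "\<exists>d>0. \<forall>S\<in>bounded_ops. dist S T < d \<longrightarrow> dist (adj_op S) (adj_op T) \<le> e"
    using \<open>e > 0\<close> by (intro exI[of _ e]) force
qed

section \<open>Hermitian operators and their quadratic forms\<close>

text \<open>Symmetry with respect to the real inner product suffices: together with complex linearity it
  gives symmetry of the complex form, so that \<open>\<langle>Tx, x\<rangle>\<close> is real and every inequality between such
  operators becomes an inequality between real quadratic forms.\<close>

definition hermitian_op :: "('h::complex_hilbert_space \<Rightarrow>\<^sub>L 'h) \<Rightarrow> bool" where
  "hermitian_op T \<longleftrightarrow> T \<in> bounded_ops \<and> (\<forall>x y. inner (T x) y = inner x (T y))"

lemma nonneg_op_iff:
  assumes T: "hermitian_op T"
  shows "nonneg_op T \<longleftrightarrow> (\<forall>x. 0 \<le> inner (T x) x)"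
proof -
  have "inner (\<i> *\<^sub>C T x) x = 0" for x
  proof -
    have "inner (\<i> *\<^sub>C T x) x = inner (\<i> *\<^sub>C x) (T x)"
      using T by (simp add: hermitian_op_def flip: bounded_opsD)
    also have "\<dots> = - inner (\<i> *\<^sub>C T x) x"
    proof -
      have "inner (\<i> *\<^sub>C a) b = - inner (\<i> *\<^sub>C b) a" for a b :: 'a
        using arg_cong[OF cinner_commute[of a b], of Im] by (simp add: cinner_eq_Complex_inner)
      then show ?thesis .
    qed
    finally show ?thesis by simp
  qed
  then show ?thesis
    using T by (simp add: nonneg_op_def hermitian_op_def cinner_eq_Complex_inner complex_is_Real_iff)
qed

text \<open>For a nonnegative form bounded by \<open>a\<close>, evaluating at \<open>x - a\<^sup>-\<^sup>1 T x\<close> gives what the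
  Cauchy--Schwarz inequality for that form would give.\<close>

lemma hermitian_norm_square_le:
  assumes T: "hermitian_op T" and "a > 0"
    and nonneg: "\<And>x. 0 \<le> inner (T x) x" and le: "\<And>x. inner (T x) x \<le> a * (norm x)\<^sup>2"
  shows "(norm (T x))\<^sup>2 \<le> a * inner (T x) x"
proof -
  define y where "y = T x"
  have sym: "inner (T y) x = inner y y"
    using T unfolding hermitian_op_def y_def by simp
  have expand: "inner (T (x - s *\<^sub>R y)) (x - s *\<^sub>R y)
      = inner (T x) x - 2 * s * inner y y + s\<^sup>2 * inner (T y) y" for s
    by (simp add: blinfun.bilinear_simps inner_simps sym power2_eq_square algebra_simps flip: y_def)
  have "(1/a)\<^sup>2 * inner (T y) y \<le> (1/a)\<^sup>2 * (a * (norm y)\<^sup>2)"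
    by (rule mult_left_mono[OF le]) simp
  also have "\<dots> = (1/a) * (norm y)\<^sup>2"
    using \<open>a > 0\<close> by (simp add: power2_eq_square)
  finally have "(norm y)\<^sup>2 / a \<le> inner (T x) x"
    using nonneg[of "x - (1/a) *\<^sub>R y"] expand[of "1/a"] by (simp add: power2_norm_eq_inner)
  then show ?thesis
    using \<open>a > 0\<close> by (simp only: pos_divide_le_eq y_def mult.commute)
qed

lemma hermitian_norm_le:
  assumes T: "hermitian_op T" and "a > 0"
    and nonneg: "\<And>x. 0 \<le> inner (T x) x" and le: "\<And>x. inner (T x) x \<le> a * (norm x)\<^sup>2"
  shows "norm T \<le> a"
proof (rule norm_blinfun_bound)
  fix x
  have "(norm (T x))\<^sup>2 \<le> a * inner (T x) x" by (rule hermitian_norm_square_le[OF assms])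
  also have "\<dots> \<le> a * (a * (norm x)\<^sup>2)"
    using \<open>a > 0\<close> by (intro mult_left_mono[OF le]) simp
  also have "\<dots> = (a * norm x)\<^sup>2" by (simp add: power2_eq_square)
  finally show "norm (T x) \<le> a * norm x"
    by (rule power2_le_imp_le) (use \<open>a > 0\<close> in simp)
qed (use \<open>a > 0\<close> in simp)

lemma inner_blinfun_le_norm:
  fixes T :: "'a::real_inner \<Rightarrow>\<^sub>L 'a"
  shows "\<bar>inner (T x) x\<bar> \<le> norm T * (norm x)\<^sup>2"
proof -
  have "\<bar>inner (T x) x\<bar> \<le> norm (T x) * norm x" by (rule Cauchy_Schwarz_ineq2)
  also have "\<dots> \<le> (norm T * norm x) * norm x" by (intro mult_right_mono norm_blinfun) simp
  finally show ?thesis by (simp add: power2_eq_square ac_simps)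
qed

definition coercive_op :: "('h::complex_hilbert_space \<Rightarrow>\<^sub>L 'h) \<Rightarrow> bool" where
  "coercive_op T \<longleftrightarrow> (\<exists>c>0. \<forall>x. c * (norm x)\<^sup>2 \<le> inner (T x) x)"

lemma coercive_op_invertible:
  fixes T :: "'h::complex_hilbert_space \<Rightarrow>\<^sub>L 'h"
  assumes T: "hermitian_op T" and "coercive_op T"
  shows "invertible_op T"
proof -
  obtain c where c: "c > 0" "\<And>x. c * (norm x)\<^sup>2 \<le> inner (T x) x"
    using assms(2) by (auto simp: coercive_op_def)
  have "\<exists>v. \<forall>x. inner (T v) x = inner y x" for y
    by (rule coercive_represents_functional[OF _ c bounded_linear_inner_right, of y])
      (use T in \<open>auto simp: hermitian_op_def\<close>)
  then obtain s where "\<And>x y. inner (T (s y)) x = inner y x" by metis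
  then have "inner (T (s y) - y) (T (s y) - y) = 0" for y by (simp only: inner_diff_left)
  then have Ts: "T (s y) = y" for y by simp
  have bound: "c * norm x \<le> norm (T x)" for x
  proof (cases "x = 0")
    case False
    have "(c * norm x) * norm x \<le> norm (T x) * norm x"
      using c(2)[of x] norm_cauchy_schwarz[of "T x" x] by (simp add: power2_eq_square)
    then show ?thesis using False by simp
  qed simp
  have inj: "x = y" if "T x = T y" for x y
    using bound[of "x - y"] that \<open>c > 0\<close>
    by (simp add: blinfun.diff_right zero_less_mult_iff mult_le_0_iff)
  have "bounded_linear s"
  proof (rule bounded_linear_intro[where K = "1 / c"])
    show "norm (s y) \<le> norm y * (1 / c)" for y
      using bound[of "s y"] \<open>c > 0\<close> by (simp add: Ts field_simps)
  qed (rule inj, simp add: Ts blinfun.bilinear_simps)+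
  then have app: "blinfun_apply (Blinfun s) = s" by (rule bounded_linear_Blinfun_apply)
  have "s (a *\<^sub>C y) = a *\<^sub>C s y" for a y
    by (rule inj) (use T in \<open>simp add: hermitian_op_def bounded_opsD Ts\<close>)
  then have "Blinfun s \<in> bounded_ops" by (simp add: bounded_ops_def app)
  moreover have "Blinfun s o\<^sub>L T = id_blinfun" "T o\<^sub>L Blinfun s = id_blinfun"
    by (rule blinfun_eqI, simp add: app Ts inj)+
  ultimately show ?thesis using T by (auto simp: invertible_op_def hermitian_op_def)
qed

text \<open>A uniform lower bound for the form is the working version of \<open>T > 0\<close>; it is stable under
  small perturbations and under adding nonnegative forms. That an invertible \<open>T \<ge> 0\<close> has one follows
  from \<open>\<parallel>x\<parallel> \<le> \<parallel>T\<^sup>-\<^sup>1\<parallel> \<parallel>Tx\<parallel>\<close> and \<open>\<parallel>Tx\<parallel>\<^sup>2 \<le> \<parallel>T\<parallel> \<langle>Tx, x\<rangle>\<close>.\<close>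

lemma pos_op_iff:
  fixes T :: "'h::complex_hilbert_space \<Rightarrow>\<^sub>L 'h"
  assumes T: "hermitian_op T"
  shows "pos_op T \<longleftrightarrow> coercive_op T"
proof
  assume coercive: "coercive_op T"
  then obtain c where c: "c > 0" "\<And>x. c * (norm x)\<^sup>2 \<le> inner (T x) x"
    by (auto simp: coercive_op_def)
  have "0 \<le> inner (T x) x" for x
    by (rule order_trans[OF _ c(2)]) (use \<open>c > 0\<close> in simp)
  then have "nonneg_op T" using nonneg_op_iff[OF T] by blast
  then show "pos_op T"
    unfolding pos_op_def using coercive_op_invertible[OF T coercive] by blast
next
  assume "pos_op T"
  then have nonneg: "0 \<le> inner (T x) x" for x
    using nonneg_op_iff[OF T] unfolding pos_op_def by blast
  obtain S where S: "S o\<^sub>L T = id_blinfun"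
    using \<open>pos_op T\<close> unfolding pos_op_def invertible_op_def by blast
  \<comment> \<open>The summand 1 keeps both constants positive when \<open>T\<close> or \<open>S\<close> is zero.\<close>
  define a b where "a = norm T + 1" and "b = norm S + 1"
  have "a > 0" unfolding a_def by (rule add_nonneg_pos) simp_all
  have "b > 0" unfolding b_def by (rule add_nonneg_pos) simp_all
  have le: "inner (T x) x \<le> a * (norm x)\<^sup>2" for x
  proof -
    have "norm T * (norm x)\<^sup>2 \<le> a * (norm x)\<^sup>2" by (simp add: a_def mult_right_mono)
    then show ?thesis using inner_blinfun_le_norm[of T x] by linarith
  qed
  have "(norm x)\<^sup>2 \<le> b\<^sup>2 * (a * inner (T x) x)" for x
  proof -
    have "S (T x) = x" using arg_cong[OF S, of "\<lambda>R. blinfun_apply R x"] by simp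
    then have "norm x \<le> norm S * norm (T x)" using norm_blinfun[of S "T x"] by simp
    also have "\<dots> \<le> b * norm (T x)" unfolding b_def by (rule mult_right_mono) simp_all
    finally have "(norm x)\<^sup>2 \<le> (b * norm (T x))\<^sup>2" by (rule power_mono) simp
    also have "\<dots> = b\<^sup>2 * (norm (T x))\<^sup>2" by (rule power_mult_distrib)
    also have "\<dots> \<le> b\<^sup>2 * (a * inner (T x) x)"
      by (intro mult_left_mono hermitian_norm_square_le[OF T \<open>a > 0\<close> nonneg le]) simp
    finally show ?thesis .
  qed
  then have "(norm x)\<^sup>2 \<le> (b\<^sup>2 * a) * inner (T x) x" for x by (simp only: mult.assoc)
  moreover have ba: "b\<^sup>2 * a > 0" using \<open>a > 0\<close> \<open>b > 0\<close> by simp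
  ultimately have "(1 / (b\<^sup>2 * a)) * (norm x)\<^sup>2 \<le> inner (T x) x" for x
    using pos_divide_le_eq[OF ba, of "(norm x)\<^sup>2" "inner (T x) x"] by (simp add: mult.commute)
  moreover have "1 / (b\<^sup>2 * a) > 0" using ba by (rule divide_pos_pos[OF zero_less_one])
  ultimately show "coercive_op T" unfolding coercive_op_def by blast
qed

lemma open_coercive_op: "open {T :: 'h::complex_hilbert_space \<Rightarrow>\<^sub>L 'h. coercive_op T}"
proof (rule openI)
  fix T :: "'h \<Rightarrow>\<^sub>L 'h" assume "T \<in> {T. coercive_op T}"
  then obtain c where c: "c > 0" "\<And>x. c * (norm x)\<^sup>2 \<le> inner (T x) x"
    by (auto simp: coercive_op_def)
  have "coercive_op S" if "S \<in> ball T (c / 2)" for S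
  proof -
    have "(c / 2) * (norm x)\<^sup>2 \<le> inner (S x) x" for x
    proof -
      have "norm (T - S) * (norm x)\<^sup>2 \<le> (c / 2) * (norm x)\<^sup>2"
        using that by (intro mult_right_mono) (auto simp: dist_norm)
      then show ?thesis
        using inner_blinfun_le_norm[of "T - S" x] c(2)[of x]
        by (simp add: blinfun.diff_left inner_diff_left abs_le_iff)
    qed
    then show ?thesis unfolding coercive_op_def using \<open>c > 0\<close> by (intro exI[of _ "c / 2"]) simp
  qed
  then show "\<exists>e>0. ball T e \<subseteq> {T. coercive_op T}"
    using \<open>c > 0\<close> by (intro exI[of _ "c / 2"]) auto
qed

lemma closed_nonneg_form: "closed {T :: 'a::real_inner \<Rightarrow>\<^sub>L 'a. \<forall>x. 0 \<le> inner (T x) x}"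
proof -
  have "closed {T :: 'a \<Rightarrow>\<^sub>L 'a. 0 \<le> inner (T x) x}" for x
    by (intro closed_Collect_le continuous_intros)
  then have "closed (\<Inter>x. {T :: 'a \<Rightarrow>\<^sub>L 'a. 0 \<le> inner (T x) x})" by blast
  then show ?thesis by (simp add: Collect_all_eq)
qed

section \<open>Defects of a commuting tuple\<close>

lemma commuting_tuples_in_bounded_ops:
  "X \<in> commuting_tuples k n \<Longrightarrow> i < k \<Longrightarrow> j < n i \<Longrightarrow> X (i, j) \<in> bounded_ops"
  by (auto simp: commuting_tuples_def op_tuples_def idx_def)

lemma hermitian_op_diff: "hermitian_op S \<Longrightarrow> hermitian_op T \<Longrightarrow> hermitian_op (S - T)"
  by (simp add: hermitian_op_def bounded_ops_diff blinfun.diff_left inner_simps)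

lemma hermitian_op_sum: "(\<And>j. j \<in> A \<Longrightarrow> hermitian_op (T j)) \<Longrightarrow> hermitian_op (\<Sum>j\<in>A. T j)"
  by (simp add: hermitian_op_def bounded_ops_sum blinfun.sum_left inner_sum_left inner_sum_right)

lemma hermitian_op_id [simp]: "hermitian_op id_blinfun"
  by (simp add: hermitian_op_def)

lemma hermitian_op_conjugate:
  assumes "T \<in> bounded_ops" "hermitian_op Y"
  shows "hermitian_op (T o\<^sub>L Y o\<^sub>L adj_op T)"
  using assms
  by (simp add: hermitian_op_def bounded_ops_compose adj_op_in_bounded_ops inner_adj_op[OF assms(1)])

lemma hermitian_op_Phi:
  assumes "\<And>j. j < n i \<Longrightarrow> X (i, j) \<in> bounded_ops" "hermitian_op Y"
  shows "hermitian_op (Phi n X i Y)"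
  unfolding Phi_def using assms by (intro hermitian_op_sum hermitian_op_conjugate) auto

lemma Phi_form:
  assumes "\<And>j. j < n i \<Longrightarrow> X (i, j) \<in> bounded_ops"
  shows "inner (Phi n X i Y x) x = (\<Sum>j<n i. inner (Y (adj_op (X (i, j)) x)) (adj_op (X (i, j)) x))"
  by (simp add: Phi_def blinfun.sum_left inner_sum_left inner_adj_op assms)

lemma Phi_id: "Phi n X i id_blinfun = (\<Sum>j<n i. X (i, j) o\<^sub>L adj_op (X (i, j)))"
  unfolding Phi_def by (intro sum.cong refl blinfun_eqI) simp

lemma Phi_diff: "Phi n X i (Y - Z) = Phi n X i Y - Phi n X i Z"
  unfolding Phi_def
  by (rule blinfun_eqI) (simp add: blinfun.bilinear_simps sum_subtractf)

text \<open>The entries of two different blocks commute, and hence so do their adjoints. Entries only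
  meet entries on the left of \<open>Y\<close> and adjoints only meet adjoints on its right, so no relation
  between entries and adjoints enters.\<close>

lemma Phi_commute:
  assumes X: "X \<in> commuting_tuples k n" and i: "i < k" and l: "l < k"
  shows "Phi n X i (Phi n X l Y) = Phi n X l (Phi n X i Y)"
proof (cases "i = l")
  case False
  have eq: "X (i, a) o\<^sub>L (X (l, b) o\<^sub>L Y o\<^sub>L adj_op (X (l, b))) o\<^sub>L adj_op (X (i, a))
      = X (l, b) o\<^sub>L (X (i, a) o\<^sub>L Y o\<^sub>L adj_op (X (i, a))) o\<^sub>L adj_op (X (l, b))"
    if "a < n i" "b < n l" for a b
  proof -
    have comm: "X (i, a) o\<^sub>L X (l, b) = X (l, b) o\<^sub>L X (i, a)"
      using X i l that False unfolding commuting_tuples_def by blast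
    have in_ops: "X (i, a) \<in> bounded_ops" "X (l, b) \<in> bounded_ops"
      using commuting_tuples_in_bounded_ops[OF X] i l that by auto
    have "adj_op (X (l, b)) o\<^sub>L adj_op (X (i, a)) = adj_op (X (i, a)) o\<^sub>L adj_op (X (l, b))"
      using arg_cong[OF comm, of adj_op] in_ops by (simp add: adj_op_compose)
    then have "adj_op (X (l, b)) (adj_op (X (i, a)) x) = adj_op (X (i, a)) (adj_op (X (l, b)) x)" for x
      using arg_cong[of _ _ "\<lambda>T. blinfun_apply T x"] by (metis blinfun_apply_blinfun_compose)
    moreover have "X (i, a) (X (l, b) x) = X (l, b) (X (i, a) x)" for x
      using arg_cong[OF comm, of "\<lambda>T. blinfun_apply T x"] by simp
    ultimately show ?thesis by (intro blinfun_eqI) simp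
  qed
  have expand: "Phi n X r (Phi n X s Y) = (\<Sum>a<n r. \<Sum>b<n s.
      X (r, a) o\<^sub>L (X (s, b) o\<^sub>L Y o\<^sub>L adj_op (X (s, b))) o\<^sub>L adj_op (X (r, a)))" for r s
    unfolding Phi_def by (rule blinfun_eqI) (simp add: blinfun.sum_left blinfun.sum_right)
  have "Phi n X i (Phi n X l Y) = (\<Sum>a<n i. \<Sum>b<n l.
      X (l, b) o\<^sub>L (X (i, a) o\<^sub>L Y o\<^sub>L adj_op (X (i, a))) o\<^sub>L adj_op (X (l, b)))"
    unfolding expand by (intro sum.cong refl) (simp add: eq)
  also have "\<dots> = Phi n X l (Phi n X i Y)" unfolding expand by (rule sum.swap)
  finally show ?thesis .
qed simp

text \<open>The operator \<open>\<Delta>\<^sub>X\<^sup>p(I)\<close> for the exponent \<open>p\<close> that is the indicator function of \<open>S\<close>. A fold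
  over the set \<open>S\<close> makes the order of the factors invisible, so that any factor can be split off
  first.\<close>

definition partial_defect ::
  "(nat \<Rightarrow> nat) \<Rightarrow> 'h::complex_hilbert_space op_tuple \<Rightarrow> nat set \<Rightarrow> ('h \<Rightarrow>\<^sub>L 'h)" where
  "partial_defect n X S = Finite_Set.fold (\<lambda>i Y. Y - Phi n X i Y) id_blinfun S"

lemma partial_defect_empty [simp]: "partial_defect n X {} = id_blinfun"
  by (simp add: partial_defect_def)

lemma partial_defect_insert:
  assumes X: "X \<in> commuting_tuples k n" and "insert i S \<subseteq> {..<k}" and "i \<notin> S"
  shows "partial_defect n X (insert i S) = partial_defect n X S - Phi n X i (partial_defect n X S)"
proof -
  interpret comp_fun_commute_on "{..<k}" "\<lambda>i Y. Y - Phi n X i Y"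
    by standard (simp add: fun_eq_iff Phi_diff Phi_commute[OF X])
  have "finite S" using assms(2) finite_subset[of S "{..<k}"] by simp
  from fold_insert[OF assms(2) this assms(3)] show ?thesis unfolding partial_defect_def .
qed

lemma hermitian_op_partial_defect:
  assumes X: "X \<in> commuting_tuples k n" and S: "S \<subseteq> {..<k}"
  shows "hermitian_op (partial_defect n X S)"
  using finite_subset[OF S finite_lessThan] S
proof (induction S rule: finite_induct)
  case (insert i S)
  then show ?case
    by (simp add: partial_defect_insert[OF X] hermitian_op_diff hermitian_op_Phi
        commuting_tuples_in_bounded_ops[OF X])
qed simp

lemma partial_defect_cong:
  assumes "X \<in> commuting_tuples k n" "X' \<in> commuting_tuples k n" and S: "S \<subseteq> {..<k}"
    and "\<And>i j. i \<in> S \<Longrightarrow> j < n i \<Longrightarrow> X (i, j) = X' (i, j)"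
  shows "partial_defect n X S = partial_defect n X' S"
  using finite_subset[OF S finite_lessThan] S assms(4)
proof (induction S rule: finite_induct)
  case (insert i S)
  then show ?case
    by (simp add: partial_defect_insert[OF assms(1)] partial_defect_insert[OF assms(2)] Phi_def)
qed simp

lemma foldr_defects_eq_partial_defect:
  assumes X: "X \<in> commuting_tuples k n"
    and "distinct is" "set is \<subseteq> {..<k}" "\<And>i. i \<in> set is \<Longrightarrow> p i \<in> {0, 1}"
  shows "foldr (\<circ>) (map (\<lambda>i. (\<lambda>Y. Y - Phi n X i Y) ^^ p i) is) id id_blinfun
      = partial_defect n X {i \<in> set is. p i = 1}"
  using assms(2-)
proof (induction "is")
  case (Cons i "is")
  let ?S = "{i \<in> set is. p i = 1}"
  have IH: "foldr (\<circ>) (map (\<lambda>i. (\<lambda>Y. Y - Phi n X i Y) ^^ p i) is) id id_blinfun = partial_defect n X ?S"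
    by (rule Cons.IH) (use Cons.prems in auto)
  have step: "foldr (\<circ>) (map (\<lambda>i. (\<lambda>Y. Y - Phi n X i Y) ^^ p i) (i # is)) id id_blinfun
      = ((\<lambda>Y. Y - Phi n X i Y) ^^ p i) (partial_defect n X ?S)"
    by (simp only: list.map foldr_Cons o_apply IH)
  consider "p i = 0" | "p i = 1" using Cons.prems(3)[of i] by auto
  then show ?case
  proof cases
    case 1
    then have "{l \<in> set (i # is). p l = 1} = ?S" by auto
    then show ?thesis using 1 by (simp only: step funpow_0)
  next
    case 2
    then have "{l \<in> set (i # is). p l = 1} = insert i ?S" by auto
    moreover have "partial_defect n X (insert i ?S) = partial_defect n X ?S - Phi n X i (partial_defect n X ?S)"
      using Cons.prems by (intro partial_defect_insert[OF X]) auto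
    moreover have "(\<lambda>Y. Y - Phi n X i Y) ^^ p i = (\<lambda>Y. Y - Phi n X i Y)"
      using 2 by (simp add: fun_eq_iff)
    ultimately show ?thesis by (simp only: step)
  qed
qed simp

lemma defect_map_pow_eq_partial_defect:
  assumes "X \<in> commuting_tuples k n" and "\<forall>i<k. p i \<in> {0, 1}"
  shows "defect_map_pow k n p X id_blinfun = partial_defect n X {i. i < k \<and> p i = 1}"
  using foldr_defects_eq_partial_defect[OF assms(1), of "[0..<k]" p] assms(2)
  by (simp add: defect_map_pow_def atLeast0LessThan)

lemma defect_map_eq_partial_defect:
  assumes "X \<in> commuting_tuples k n"
  shows "defect_map k n X id_blinfun = partial_defect n X {..<k}"
proof -
  have "defect_map k n X = defect_map_pow k n (\<lambda>_. 1) X"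
    by (simp add: defect_map_def defect_map_pow_def)
  moreover have "{i. i < k \<and> (1::nat) = 1} = {..<k}" by auto
  ultimately show ?thesis
    using defect_map_pow_eq_partial_defect[OF assms, of "\<lambda>_. 1"] by simp
qed

text \<open>This set turns out to be the norm closure of the polyball.\<close>

definition nonneg_defect_tuples ::
  "nat \<Rightarrow> (nat \<Rightarrow> nat) \<Rightarrow> 'h::complex_hilbert_space op_tuple set" where
  "nonneg_defect_tuples k n = {X \<in> commuting_tuples k n.
     \<forall>S\<subseteq>{..<k}. \<forall>x. 0 \<le> inner (partial_defect n X S x) x}"

lemma nonneg_defect_tuples_eq:
  "nonneg_defect_tuples k n = {X \<in> commuting_tuples k n.
     \<forall>p. (\<forall>i<k. p i \<in> {0, 1}) \<longrightarrow> nonneg_op (defect_map_pow k n p X id_blinfun)}"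
proof -
  have "(\<forall>S\<subseteq>{..<k}. \<forall>x. 0 \<le> inner (partial_defect n X S x) x) \<longleftrightarrow>
      (\<forall>p. (\<forall>i<k. p i \<in> {0, 1}) \<longrightarrow> nonneg_op (defect_map_pow k n p X id_blinfun))" (is "?L \<longleftrightarrow> ?R")
    if X: "X \<in> commuting_tuples k n" for X :: "'a op_tuple"
  proof -
    have nonneg: "nonneg_op (partial_defect n X S) \<longleftrightarrow> (\<forall>x. 0 \<le> inner (partial_defect n X S x) x)"
      if "S \<subseteq> {..<k}" for S
      by (rule nonneg_op_iff[OF hermitian_op_partial_defect[OF X that]])
    show ?thesis
    proof
      assume L: ?L
      show ?R
      proof (intro allI impI)
        fix p :: "nat \<Rightarrow> nat" assume p: "\<forall>i<k. p i \<in> {0, 1}"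
        have sub: "{i. i < k \<and> p i = 1} \<subseteq> {..<k}" by auto
        show "nonneg_op (defect_map_pow k n p X id_blinfun)"
          unfolding defect_map_pow_eq_partial_defect[OF X p] nonneg[OF sub] using L sub by blast
      qed
    next
      assume R: ?R
      show ?L
      proof (intro allI impI)
        fix S and x assume S: "S \<subseteq> {..<k}"
        define p :: "nat \<Rightarrow> nat" where "p i = (if i \<in> S then 1 else 0)" for i
        have p: "\<forall>i<k. p i \<in> {0, 1}" by (simp add: p_def)
        have "{i. i < k \<and> p i = 1} = S" using S by (auto simp: p_def split: if_splits)
        then have "defect_map_pow k n p X id_blinfun = partial_defect n X S"
          using defect_map_pow_eq_partial_defect[OF X p] by simp
        then show "0 \<le> inner (partial_defect n X S x) x" using R p nonneg[OF S] by metis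
      qed
    qed
  qed
  then show ?thesis unfolding nonneg_defect_tuples_def by blast
qed

lemma polyball_eq:
  "polyball k n = {X \<in> commuting_tuples k n.
     (\<forall>i<k. norm (Phi n X i id_blinfun) < 1) \<and> coercive_op (partial_defect n X {..<k})}"
proof -
  have "pos_op (defect_map k n X id_blinfun) \<longleftrightarrow> coercive_op (partial_defect n X {..<k})"
    if "X \<in> commuting_tuples k n" for X :: "'a op_tuple"
    unfolding defect_map_eq_partial_defect[OF that]
    by (rule pos_op_iff[OF hermitian_op_partial_defect[OF that order_refl]])
  then show ?thesis unfolding polyball_def Phi_id by blast
qed

section \<open>Positivity of all partial defects on the polyball\<close>

text \<open>A contractive \<open>\<Phi>\<close> reflects positivity through \<open>id - \<Phi>\<close>: any lower bound \<open>-M\<close> for the form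
  of \<open>Y\<close> improves to \<open>-qM\<close>, because \<open>Y \<ge> \<Phi>(Y) \<ge> -M \<Phi>(I) \<ge> -qM\<close>.\<close>

lemma nonneg_if_diff_Phi_nonneg:
  assumes X: "\<And>j. j < n i \<Longrightarrow> X (i, j) \<in> bounded_ops"
    and q: "norm (Phi n X i id_blinfun) < 1"
    and ge: "\<And>x. 0 \<le> inner ((Y - Phi n X i Y) x) x"
  shows "0 \<le> inner (blinfun_apply Y x) x"
proof -
  define q where "q = norm (Phi n X i id_blinfun)"
  have "0 \<le> q" "q < 1" using assms(2) by (simp_all add: q_def)
  define M where "M = norm Y"
  have "0 \<le> M" by (simp add: M_def)
  have lower: "- (M * q ^ m) * (norm x)\<^sup>2 \<le> inner (Y x) x" for m x
  proof (induction m arbitrary: x)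
    case 0
    then show ?case using inner_blinfun_le_norm[of Y x] by (simp add: M_def)
  next
    case (Suc m)
    let ?a = "\<lambda>j. adj_op (X (i, j)) x"
    have "(\<Sum>j<n i. (norm (?a j))\<^sup>2) \<le> q * (norm x)\<^sup>2"
      using Phi_form[of n i X id_blinfun x, OF X] inner_blinfun_le_norm[of "Phi n X i id_blinfun" x]
      by (simp add: q_def power2_norm_eq_inner)
    then have "(M * q ^ m) * (\<Sum>j<n i. (norm (?a j))\<^sup>2) \<le> (M * q ^ m) * (q * (norm x)\<^sup>2)"
      using \<open>0 \<le> q\<close> \<open>0 \<le> M\<close> by (intro mult_left_mono) simp_all
    then have "- (M * q ^ Suc m) * (norm x)\<^sup>2 \<le> (\<Sum>j<n i. - (M * q ^ m) * (norm (?a j))\<^sup>2)"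
      by (simp add: sum_negf ac_simps flip: sum_distrib_left)
    also have "\<dots> \<le> (\<Sum>j<n i. inner (Y (?a j)) (?a j))" by (intro sum_mono Suc.IH)
    also have "\<dots> = inner (Phi n X i Y x) x" by (rule Phi_form[of n i X Y x, OF X, symmetric])
    also have "\<dots> \<le> inner (Y x) x" using ge[of x] by (simp add: blinfun.diff_left inner_diff_left)
    finally show ?case .
  qed
  have "(\<lambda>m. - (M * q ^ m) * (norm x)\<^sup>2) \<longlonglongrightarrow> - (M * 0) * (norm x)\<^sup>2"
    using \<open>0 \<le> q\<close> \<open>q < 1\<close> by (intro tendsto_intros LIMSEQ_power_zero) simp
  then have "- (M * 0) * (norm x)\<^sup>2 \<le> inner (Y x) x"
    by (rule LIMSEQ_le_const2) (use lower in blast)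
  then show ?thesis by simp
qed

text \<open>Removing one factor \<open>id - \<Phi>\<^sub>i\<close> at a time from the full defect preserves positivity, by the
  preceding lemma.\<close>

lemma polyball_subset_nonneg_defect_tuples: "polyball k n \<subseteq> nonneg_defect_tuples k n"
proof
  fix X :: "'h::complex_hilbert_space op_tuple" assume "X \<in> polyball k n"
  then have X: "X \<in> commuting_tuples k n" and q: "\<And>i. i < k \<Longrightarrow> norm (Phi n X i id_blinfun) < 1"
    and coercive: "coercive_op (partial_defect n X {..<k})"
    by (auto simp: polyball_eq)
  \<comment> \<open>The induction is on the set \<open>A\<close> of removed factors.\<close>
  have "\<forall>x. 0 \<le> inner (partial_defect n X ({..<k} - A) x) x" if "A \<subseteq> {..<k}" for A
    using finite_subset[OF that finite_lessThan] that
  proof (induction A rule: finite_induct)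
    case empty
    obtain c where c: "c > 0" "\<And>x. c * (norm x)\<^sup>2 \<le> inner (partial_defect n X {..<k} x) x"
      using coercive by (auto simp: coercive_op_def)
    have "0 \<le> inner (partial_defect n X {..<k} x) x" for x
      by (rule order_trans[OF _ c(2)]) (use \<open>c > 0\<close> in simp)
    then show ?case by simp
  next
    case (insert i A)
    let ?S = "{..<k} - insert i A"
    have "i < k" using insert by auto
    have "{..<k} - A = insert i ?S" using insert by auto
    then have "partial_defect n X ({..<k} - A) = partial_defect n X ?S - Phi n X i (partial_defect n X ?S)"
      using partial_defect_insert[OF X, of i ?S] \<open>i < k\<close> by auto
    then have "0 \<le> inner ((partial_defect n X ?S - Phi n X i (partial_defect n X ?S)) x) x" for x
      using insert by simp
    from nonneg_if_diff_Phi_nonneg[OF _ q this] show ?case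
      using commuting_tuples_in_bounded_ops[OF X] \<open>i < k\<close> by blast
  qed
  note nonneg = this
  have "0 \<le> inner (partial_defect n X S x) x" if "S \<subseteq> {..<k}" for S x
  proof -
    have "{..<k} - ({..<k} - S) = S" using that by auto
    then show ?thesis using nonneg[of "{..<k} - S"] by simp
  qed
  then show "X \<in> nonneg_defect_tuples k n"
    unfolding nonneg_defect_tuples_def using X by blast
qed

section \<open>Scaling the blocks one at a time\<close>

lemma scale_tuple_in_commuting_tuples:
  assumes X: "X \<in> commuting_tuples k n"
  shows "scale_tuple k n z X \<in> commuting_tuples k n"
proof -
  have "scaleC_op a S o\<^sub>L scaleC_op b T = scaleC_op b T o\<^sub>L scaleC_op a S"
    if "S \<in> bounded_ops" "T \<in> bounded_ops" "S o\<^sub>L T = T o\<^sub>L S" for S T :: "'a \<Rightarrow>\<^sub>L 'a" and a b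
  proof (rule blinfun_eqI)
    fix x
    have "S (T x) = T (S x)" using arg_cong[OF that(3), of "\<lambda>R. blinfun_apply R x"] by simp
    then show "blinfun_apply (scaleC_op a S o\<^sub>L scaleC_op b T) x = blinfun_apply (scaleC_op b T o\<^sub>L scaleC_op a S) x"
      using that(1,2) by (simp add: bounded_opsD scaleC_scaleC mult.commute)
  qed
  moreover have "scale_tuple k n z X \<in> op_tuples k n"
    using commuting_tuples_in_bounded_ops[OF X]
    by (auto simp: op_tuples_def scale_tuple_def idx_def intro: bounded_ops_scaleC)
  ultimately show ?thesis
    using X commuting_tuples_in_bounded_ops[OF X]
    by (simp add: commuting_tuples_def scale_tuple_def idx_def)
qed

lemma commuting_tuples_extensional: "X \<in> commuting_tuples k n \<Longrightarrow> X \<in> extensional (idx k n)"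
  by (auto simp: commuting_tuples_def op_tuples_def PiE_def)

lemma scale_tuple_scale_tuple:
  "scale_tuple k n z (scale_tuple k n w X) = scale_tuple k n (\<lambda>ij. z ij * w ij) X"
  by (auto simp: scale_tuple_def scaleC_op_scaleC_op)

lemma scale_tuple_one: "X \<in> extensional (idx k n) \<Longrightarrow> scale_tuple k n (\<lambda>_. 1) X = X"
  by (auto simp: scale_tuple_def extensional_def)

lemma scale_tuple_cong:
  "(\<And>ij. ij \<in> idx k n \<Longrightarrow> z ij = w ij) \<Longrightarrow> scale_tuple k n z X = scale_tuple k n w X"
  by (auto simp: scale_tuple_def)

lemma scaleR_tuple_eq_scale_tuple:
  "scaleR_tuple k n r X = scale_tuple k n (\<lambda>_. complex_of_real r) X"
  by (simp add: scaleR_tuple_def scale_tuple_def scaleC_op_of_real)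

lemma Phi_scale_tuple_form:
  assumes X: "X \<in> commuting_tuples k n" and i: "i < k" and Y: "Y \<in> bounded_ops"
  shows "inner (Phi n (scale_tuple k n z X) i Y x) x =
    (\<Sum>j<n i. (cmod (z (i, j)))\<^sup>2 * inner (Y (adj_op (X (i, j)) x)) (adj_op (X (i, j)) x))"
proof -
  note in_ops = commuting_tuples_in_bounded_ops[OF X i]
  have scale_form: "inner (Y (c *\<^sub>C v)) (c *\<^sub>C v) = (cmod c)\<^sup>2 * inner (Y v) v" for c v
  proof -
    have "cinner (Y (c *\<^sub>C v)) (c *\<^sub>C v) = (c * cnj c) * cinner (Y v) v"
      by (simp add: bounded_opsD[OF Y] cinner_scaleC_left cinner_scaleC_right)
    then show ?thesis by (simp add: inner_eq_Re_cinner flip: complex_norm_square of_real_power)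
  qed
  have entry: "scale_tuple k n z X (i, j) = scaleC_op (z (i, j)) (X (i, j))" if "j < n i" for j
    using i that by (simp add: scale_tuple_def idx_def)
  show ?thesis
    by (subst Phi_form) (simp_all add: entry bounded_ops_scaleC in_ops adj_op_scaleC scale_form)
qed

text \<open>Write \<open>q \<ge> \<bar>z\<bar>\<^sup>2\<close> and let \<open>\<Phi>'\<close> be the scaled map. If \<open>Y \<ge> 0\<close> then
  \<open>Y - \<Phi>'(Y) \<ge> Y - q \<Phi>(Y) = (1 - q) Y + q (Y - \<Phi>(Y))\<close>, a convex combination when
  \<open>0 \<le> q \<le> 1\<close>.\<close>

lemma scaled_diff_Phi_form_ge:
  assumes X: "X \<in> commuting_tuples k n" and i: "i < k" and Y: "Y \<in> bounded_ops"
    and nonneg: "\<And>x. 0 \<le> inner (blinfun_apply Y x) x"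
    and z: "\<And>j. j < n i \<Longrightarrow> (cmod (z (i, j)))\<^sup>2 \<le> q"
  shows "(1 - q) * inner (Y x) x + q * inner ((Y - Phi n X i Y) x) x
    \<le> inner ((Y - Phi n (scale_tuple k n z X) i Y) x) x"
proof -
  have "inner (Phi n (scale_tuple k n z X) i Y x) x
      \<le> (\<Sum>j<n i. q * inner (Y (adj_op (X (i, j)) x)) (adj_op (X (i, j)) x))"
    unfolding Phi_scale_tuple_form[OF X i Y] by (intro sum_mono mult_right_mono nonneg z) simp
  also have "\<dots> = q * inner (Phi n X i Y x) x"
    by (subst Phi_form) (simp_all add: commuting_tuples_in_bounded_ops[OF X i] sum_distrib_left)
  finally show ?thesis by (simp add: blinfun.diff_left inner_diff_left algebra_simps)
qed

text \<open>The partial defects without the factor \<open>i\<close> do not see a change of the block \<open>i\<close>, and those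
  with it are bounded below by the convex combination above. Both of its terms are nonnegative, and
  the first one carries a lower bound for \<open>S\<close> over to \<open>insert i S\<close>.\<close>

lemma scale_one_block:
  assumes X: "X \<in> nonneg_defect_tuples k n" and i: "i < k"
    and "0 \<le> q" "q \<le> 1" and z: "\<And>j. j < n i \<Longrightarrow> (cmod (z (i, j)))\<^sup>2 \<le> q"
    and z1: "\<And>l j. l \<noteq> i \<Longrightarrow> z (l, j) = 1"
  shows "scale_tuple k n z X \<in> nonneg_defect_tuples k n"
    and "S \<subseteq> {..<k} \<Longrightarrow> i \<notin> S \<Longrightarrow>
      (1 - q) * inner (partial_defect n X S x) x
        \<le> inner (partial_defect n (scale_tuple k n z X) (insert i S) x) x"
proof -
  let ?X' = "scale_tuple k n z X"
  have comm: "X \<in> commuting_tuples k n" and nonneg: "0 \<le> inner (partial_defect n X S x) x"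
    if "S \<subseteq> {..<k}" for S x using X that by (auto simp: nonneg_defect_tuples_def)
  note comm = comm[OF empty_subsetI]
  note comm' = scale_tuple_in_commuting_tuples[OF comm, of z]
  have same: "partial_defect n ?X' S = partial_defect n X S" if "S \<subseteq> {..<k}" "i \<notin> S" for S
  proof (rule partial_defect_cong[OF comm' comm that(1)])
    fix l j assume "l \<in> S" "j < n l"
    then have "z (l, j) = 1" "(l, j) \<in> idx k n" using that z1[of l j] by (auto simp: idx_def)
    then show "?X' (l, j) = X (l, j)" by (simp add: scale_tuple_def)
  qed
  have ge: "(1 - q) * inner (partial_defect n X S x) x + q * inner (partial_defect n X (insert i S) x) x
      \<le> inner (partial_defect n ?X' (insert i S) x) x" if S: "S \<subseteq> {..<k}" "i \<notin> S" for S x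
  proof -
    have iS: "insert i S \<subseteq> {..<k}" using S i by auto
    show ?thesis
      unfolding partial_defect_insert[OF comm' iS S(2)] partial_defect_insert[OF comm iS S(2)] same[OF S]
      using hermitian_op_partial_defect[OF comm S(1)]
      by (intro scaled_diff_Phi_form_ge comm i nonneg S z) (auto simp: hermitian_op_def)
  qed
  have ge0: "(1 - q) * inner (partial_defect n X S x) x \<le> inner (partial_defect n ?X' (insert i S) x) x"
    if S: "S \<subseteq> {..<k}" "i \<notin> S" for S x
  proof -
    have "insert i S \<subseteq> {..<k}" using S i by auto
    then have "0 \<le> q * inner (partial_defect n X (insert i S) x) x"
      using nonneg \<open>0 \<le> q\<close> by (intro mult_nonneg_nonneg)
    then show ?thesis using ge[OF S, of x] by linarith
  qed
  then show "S \<subseteq> {..<k} \<Longrightarrow> i \<notin> S \<Longrightarrow> (1 - q) * inner (partial_defect n X S x) x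
      \<le> inner (partial_defect n ?X' (insert i S) x) x" .
  have "0 \<le> inner (partial_defect n ?X' S x) x" if S: "S \<subseteq> {..<k}" for S x
  proof (cases "i \<in> S")
    case True
    have S': "S - {i} \<subseteq> {..<k}" "i \<notin> S - {i}" using S by auto
    have "0 \<le> (1 - q) * inner (partial_defect n X (S - {i}) x) x"
      using nonneg[OF S'(1)] \<open>q \<le> 1\<close> by (intro mult_nonneg_nonneg) simp_all
    also have "\<dots> \<le> inner (partial_defect n ?X' S x) x"
      using ge0[OF S', of x] True by (simp add: insert_absorb)
    finally show ?thesis .
  next
    case False
    then show ?thesis using same[OF S] nonneg[OF S] by simp
  qed
  then show "?X' \<in> nonneg_defect_tuples k n"
    using comm' by (simp add: nonneg_defect_tuples_def)
qed

text \<open>Every block that is scaled contributes a factor \<open>1 - q\<close> to the lower bound, which starts at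
  \<open>\<Delta>\<^sup>0(I) = I\<close>.\<close>

lemma scale_all_blocks:
  assumes X: "X \<in> nonneg_defect_tuples k n"
    and q: "0 \<le> q" "q \<le> 1" and z: "\<And>ij. ij \<in> idx k n \<Longrightarrow> (cmod (z ij))\<^sup>2 \<le> q"
  shows "scale_tuple k n z X \<in> nonneg_defect_tuples k n"
    and "(1 - q) ^ k * (norm x)\<^sup>2 \<le> inner (partial_defect n (scale_tuple k n z X) {..<k} x) x"
proof -
  have X0: "X \<in> extensional (idx k n)"
    using X commuting_tuples_extensional by (auto simp: nonneg_defect_tuples_def)
  \<comment> \<open>The weights after the first \<open>m\<close> blocks have been scaled.\<close>
  define w where "w m = (\<lambda>(i, j). if i < m then z (i, j) else 1)" for m :: nat
  have "scale_tuple k n (w m) X \<in> nonneg_defect_tuples k n \<and>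
      (\<forall>x. (1 - q) ^ m * (norm x)\<^sup>2 \<le> inner (partial_defect n (scale_tuple k n (w m) X) {..<m} x) x)"
    if "m \<le> k" for m
    using that
  proof (induction m)
    case 0
    have "w 0 = (\<lambda>_. 1)" by (simp add: w_def fun_eq_iff)
    then show ?case using X X0 by (simp add: scale_tuple_one power2_norm_eq_inner)
  next
    case (Suc m)
    define u where "u = (\<lambda>(i, j). if i = m then z (i, j) else 1)"
    have "scale_tuple k n (w (Suc m)) X = scale_tuple k n u (scale_tuple k n (w m) X)"
      unfolding scale_tuple_scale_tuple
      by (rule scale_tuple_cong) (auto simp: w_def u_def split: if_splits)
    moreover have IH: "scale_tuple k n (w m) X \<in> nonneg_defect_tuples k n"
      "\<And>x. (1 - q) ^ m * (norm x)\<^sup>2 \<le> inner (partial_defect n (scale_tuple k n (w m) X) {..<m} x) x"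
      using Suc by auto
    moreover have "m < k" using Suc.prems by simp
    have u: "\<And>j. j < n m \<Longrightarrow> (cmod (u (m, j)))\<^sup>2 \<le> q" "\<And>l j. l \<noteq> m \<Longrightarrow> u (l, j) = 1"
      using z \<open>m < k\<close> by (simp_all add: u_def idx_def)
    note block = scale_one_block[where z = u, OF IH(1) \<open>m < k\<close> q u]
    have "(1 - q) ^ Suc m * (norm x)\<^sup>2
        \<le> inner (partial_defect n (scale_tuple k n u (scale_tuple k n (w m) X)) {..<Suc m} x) x" for x
    proof -
      have "(1 - q) ^ Suc m * (norm x)\<^sup>2 = (1 - q) * ((1 - q) ^ m * (norm x)\<^sup>2)" by simp
      also have "\<dots> \<le> (1 - q) * inner (partial_defect n (scale_tuple k n (w m) X) {..<m} x) x"
        using q by (intro mult_left_mono IH(2)) simp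
      also have "\<dots> \<le> inner (partial_defect n (scale_tuple k n u (scale_tuple k n (w m) X)) (insert m {..<m}) x) x"
        using \<open>m < k\<close> by (intro block(2)) auto
      finally show ?thesis by (simp only: lessThan_Suc)
    qed
    ultimately show ?case using block(1) by simp
  qed
  moreover have "scale_tuple k n (w k) X = scale_tuple k n z X"
    by (rule scale_tuple_cong) (auto simp: w_def idx_def)
  ultimately show "scale_tuple k n z X \<in> nonneg_defect_tuples k n"
    and "(1 - q) ^ k * (norm x)\<^sup>2 \<le> inner (partial_defect n (scale_tuple k n z X) {..<k} x) x"
    by (metis order_refl)+
qed

text \<open>The coercivity is that of the preceding lemma with \<open>q = s\<^sup>2\<close>. Taking \<open>S = {i}\<close> in the
  definition of \<^const>\<open>nonneg_defect_tuples\<close> gives \<open>\<Phi>\<^sub>i(I) \<le> I\<close>, hence the norm bound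
  \<open>s\<^sup>2 < 1\<close> after scaling.\<close>

lemma scale_tuple_in_polyball:
  assumes X: "X \<in> nonneg_defect_tuples k n"
    and s: "0 < s" "s < 1" and z: "\<And>ij. ij \<in> idx k n \<Longrightarrow> cmod (z ij) \<le> s"
  shows "scale_tuple k n z X \<in> polyball k n"
proof -
  define q where "q = s\<^sup>2"
  have q: "0 < q" "q < 1" using s by (simp_all add: q_def power_less_one_iff)
  have zq: "(cmod (z ij))\<^sup>2 \<le> q" if "ij \<in> idx k n" for ij
    unfolding q_def by (rule power_mono[OF z[OF that]]) simp
  have comm: "X \<in> commuting_tuples k n" using X by (simp add: nonneg_defect_tuples_def)
  have ge: "(1 - q) ^ k * (norm x)\<^sup>2 \<le> inner (partial_defect n (scale_tuple k n z X) {..<k} x) x" for x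
    using q by (intro scale_all_blocks(2)[OF X _ _ zq]) simp_all
  have "(1 - q) ^ k > 0" using q by simp
  with ge have "coercive_op (partial_defect n (scale_tuple k n z X) {..<k})"
    unfolding coercive_op_def by blast
  moreover have "norm (Phi n (scale_tuple k n z X) i id_blinfun) < 1" if i: "i < k" for i
  proof -
    note comm' = scale_tuple_in_commuting_tuples[OF comm, of z]
    let ?P = "Phi n (scale_tuple k n z X) i id_blinfun"
    have "norm ?P \<le> q"
    proof (rule hermitian_norm_le[OF _ q(1)])
      show "hermitian_op ?P"
        by (rule hermitian_op_Phi) (simp_all add: commuting_tuples_in_bounded_ops[OF comm' i])
      fix x
      have form: "inner (?P x) x = (\<Sum>j<n i. (cmod (z (i, j)))\<^sup>2 * (norm (adj_op (X (i, j)) x))\<^sup>2)"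
        by (simp add: Phi_scale_tuple_form[OF comm i] power2_norm_eq_inner)
      show "0 \<le> inner (?P x) x" unfolding form by (intro sum_nonneg) simp
      have "partial_defect n X {i} = id_blinfun - Phi n X i id_blinfun"
        using partial_defect_insert[OF comm, of i "{}"] i by simp
      moreover have "0 \<le> inner (partial_defect n X {i} x) x"
        using X i by (auto simp: nonneg_defect_tuples_def)
      ultimately have contr: "inner (Phi n X i id_blinfun x) x \<le> (norm x)\<^sup>2"
        by (simp add: blinfun.diff_left inner_diff_left power2_norm_eq_inner)
      have "inner (?P x) x \<le> (\<Sum>j<n i. q * (norm (adj_op (X (i, j)) x))\<^sup>2)"
        unfolding form using i by (intro sum_mono mult_right_mono zq) (auto simp: idx_def)
      also have "\<dots> = q * inner (Phi n X i id_blinfun x) x"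
        by (subst Phi_form)
          (simp_all add: commuting_tuples_in_bounded_ops[OF comm i] sum_distrib_left power2_norm_eq_inner)
      also have "\<dots> \<le> q * (norm x)\<^sup>2" using q contr by (intro mult_left_mono) simp_all
      finally show "inner (?P x) x \<le> q * (norm x)\<^sup>2" .
    qed
    then show ?thesis using q by linarith
  qed
  ultimately show ?thesis
    unfolding polyball_eq using scale_tuple_in_commuting_tuples[OF comm] by blast
qed

section \<open>Openness, closure and connectedness\<close>

lemma topspace_op_topology [simp]: "topspace (op_topology k n) = op_tuples k n"
  by (simp add: op_topology_def op_tuples_def)

lemma commuting_subset_op_tuples: "commuting_tuples k n \<subseteq> op_tuples k n"
  by (auto simp: commuting_tuples_def)

lemma continuous_map_entry:
  assumes "i < k" "j < n i"
  shows "continuous_map (op_topology k n) euclidean (\<lambda>X. X (i, j))"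
    and "continuous_map (op_topology k n) euclidean (\<lambda>X. adj_op (X (i, j)))"
proof -
  have *: "continuous_map (op_topology k n) (top_of_set bounded_ops) (\<lambda>X. X (i, j))"
    unfolding op_topology_def using assms by (intro continuous_map_product_projection) (simp add: idx_def)
  then show "continuous_map (op_topology k n) euclidean (\<lambda>X. X (i, j))"
    by (rule continuous_map_into_fulltopology)
  have "continuous_map (top_of_set bounded_ops) euclidean adj_op"
    by (simp add: continuous_on_adj_op)
  from continuous_map_compose[OF * this]
  show "continuous_map (op_topology k n) euclidean (\<lambda>X. adj_op (X (i, j)))"
    by (simp add: o_def)
qed

lemma continuous_map_blinfun_compose:
  assumes "continuous_map T euclidean f" "continuous_map T euclidean g"
  shows "continuous_map T euclidean (\<lambda>x. f x o\<^sub>L g x)"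
  using assms unfolding continuous_map_atin limitin_canonical_iff
  by (blast intro: bounded_bilinear.tendsto[OF bounded_bilinear_blinfun_compose])

lemma continuous_map_Phi:
  assumes "i < k" and Y: "continuous_map (subtopology (op_topology k n) A) euclidean Y"
  shows "continuous_map (subtopology (op_topology k n) A) euclidean (\<lambda>X. Phi n X i (Y X))"
  unfolding Phi_def
  by (intro continuous_map_sum continuous_map_blinfun_compose Y
      continuous_map_from_subtopology continuous_map_entry \<open>i < k\<close>) simp_all

lemma continuous_map_partial_defect:
  assumes "S \<subseteq> {..<k}"
  shows "continuous_map (subtopology (op_topology k n) (commuting_tuples k n)) euclidean
    (\<lambda>X. partial_defect n X S)"
  using finite_subset[OF assms finite_lessThan] assms
proof (induction S rule: finite_induct)
  case (insert i S)
  let ?T = "subtopology (op_topology k n) (commuting_tuples k n) :: 'a op_tuple topology"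
  have "continuous_map ?T euclidean (\<lambda>X. partial_defect n X S - Phi n X i (partial_defect n X S))"
    using insert by (intro continuous_map_diff continuous_map_Phi) auto
  moreover have "partial_defect n X S - Phi n X i (partial_defect n X S) = partial_defect n X (insert i S)"
    if "X \<in> topspace ?T" for X
    using that insert by (intro partial_defect_insert[symmetric]) auto
  ultimately show ?case by (rule continuous_map_eq)
qed simp

lemma closedin_commuting_tuples:
  "closedin (op_topology k n) (commuting_tuples k n :: 'h::complex_hilbert_space op_tuple set)"
proof -
  define Q :: "(nat \<times> nat \<times> nat \<times> nat) set" where
    "Q = {(s, t, i, j). s < k \<and> t < k \<and> s \<noteq> t \<and> i < n s \<and> j < n t}"
  define C where "C = (\<lambda>(s, t, i, j). {X :: 'h op_tuple. X \<in> topspace (op_topology k n) \<and>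
    (X (s, i) o\<^sub>L X (t, j)) - (X (t, j) o\<^sub>L X (s, i)) \<in> {0}})"
  have "closedin (op_topology k n) (C p)" if "p \<in> Q" for p
  proof -
    obtain s t i j where p: "p = (s, t, i, j)" by (cases p) auto
    show ?thesis
      using that unfolding p C_def prod.case
      by (intro closedin_continuous_map_preimage[where Y = euclidean] continuous_map_diff
          continuous_map_blinfun_compose continuous_map_entry) (auto simp: Q_def)
  qed
  then have "closedin (op_topology k n) (topspace (op_topology k n) \<inter> (\<Inter>p\<in>Q. C p))"
    using closedin_topspace[of "op_topology k n"]
    by (cases "Q = {}") (simp del: topspace_op_topology, blast)
  also have "topspace (op_topology k n) \<inter> (\<Inter>p\<in>Q. C p) = commuting_tuples k n"
  proof (intro equalityI subsetI)
    fix X :: "'h op_tuple" assume X: "X \<in> topspace (op_topology k n) \<inter> (\<Inter>p\<in>Q. C p)"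
    have "X (s, i) o\<^sub>L X (t, j) = X (t, j) o\<^sub>L X (s, i)"
      if "s < k" "t < k" "s \<noteq> t" "i < n s" "j < n t" for s t i j
    proof -
      have "X \<in> C (s, t, i, j)" using X that by (auto simp: Q_def)
      then show ?thesis by (simp add: C_def)
    qed
    then show "X \<in> commuting_tuples k n" using X by (simp add: commuting_tuples_def)
  qed (auto simp: C_def Q_def commuting_tuples_def)
  finally show ?thesis .
qed

lemma closedin_nonneg_defect_tuples: "closedin (op_topology k n) (nonneg_defect_tuples k n)"
proof -
  let ?T = "subtopology (op_topology k n) (commuting_tuples k n) :: 'a op_tuple topology"
  have top: "topspace ?T = commuting_tuples k n"
    using commuting_subset_op_tuples[of k n] by auto
  have "closedin ?T {X \<in> topspace ?T. partial_defect n X S \<in> {T. \<forall>x. 0 \<le> inner (blinfun_apply T x) x}}"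
    if "S \<subseteq> {..<k}" for S
    by (rule closedin_continuous_map_preimage[OF continuous_map_partial_defect[OF that]])
      (simp add: closed_nonneg_form)
  then have "closedin ?T (\<Inter>S\<in>Pow {..<k}. {X \<in> topspace ?T. partial_defect n X S \<in> {T. \<forall>x. 0 \<le> inner (blinfun_apply T x) x}})"
    by (intro closedin_INT) auto
  also have "\<dots> = nonneg_defect_tuples k n"
    unfolding top nonneg_defect_tuples_def by auto
  finally show ?thesis by (rule closedin_trans_full[OF _ closedin_commuting_tuples])
qed

lemma openin_polyball: "openin (subtopology (op_topology k n) (commuting_tuples k n)) (polyball k n)"
proof -
  let ?T = "subtopology (op_topology k n) (commuting_tuples k n) :: 'a op_tuple topology"
  have top: "topspace ?T = commuting_tuples k n"
    using commuting_subset_op_tuples[of k n] by auto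
  have 1: "openin ?T {X \<in> topspace ?T. partial_defect n X {..<k} \<in> {T. coercive_op T}}"
    by (rule openin_continuous_map_preimage[OF continuous_map_partial_defect])
      (simp_all add: open_coercive_op)
  have 2: "openin ?T {X \<in> topspace ?T. Phi n X i id_blinfun \<in> ball 0 1}" if "i < k" for i
    by (rule openin_continuous_map_preimage[OF continuous_map_Phi[OF that]]) simp_all
  have "openin ?T ({X \<in> topspace ?T. partial_defect n X {..<k} \<in> {T. coercive_op T}}
      \<inter> (topspace ?T \<inter> (\<Inter>i\<in>{..<k}. {X \<in> topspace ?T. Phi n X i id_blinfun \<in> ball 0 1})))"
    by (rule openin_Int[OF 1], cases "k = 0")
      (use 2 in \<open>auto intro!: openin_Int openin_INT2 simp del: topspace_subtopology\<close>)
  also have "\<dots> = polyball k n" unfolding top polyball_eq by auto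
  finally show ?thesis .
qed

lemma continuous_map_scaleR_tuple:
  assumes X: "X \<in> op_tuples k n"
  shows "continuous_map euclideanreal (op_topology k n) (\<lambda>r. scaleR_tuple k n r X)"
  unfolding op_topology_def continuous_map_componentwise
proof (intro conjI ballI)
  show "(\<lambda>r. scaleR_tuple k n r X) ` topspace euclideanreal \<subseteq> extensional (idx k n)"
    by (auto simp: scaleR_tuple_def)
  fix ij assume ij: "ij \<in> idx k n"
  then have "X ij \<in> bounded_ops" using X by (auto simp: op_tuples_def)
  then have "r *\<^sub>R X ij \<in> bounded_ops" for r
    using bounded_ops_scaleC[of "X ij" "complex_of_real r"] by (simp add: scaleC_op_of_real)
  moreover have "continuous_on UNIV (\<lambda>r. r *\<^sub>R X ij)" by (intro continuous_intros)
  ultimately show "continuous_map euclideanreal (top_of_set bounded_ops) (\<lambda>r. scaleR_tuple k n r X ij)"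
    using ij by (auto simp: scaleR_tuple_def continuous_map_in_subtopology)
qed

lemma scaleR_tuple_one: "X \<in> op_tuples k n \<Longrightarrow> scaleR_tuple k n 1 X = X"
  unfolding scaleR_tuple_eq_scale_tuple
  using scale_tuple_one[of X k n] by (auto simp: op_tuples_def PiE_def)

text \<open>Parameters \<open>r < 1\<close> will show that \<open>X\<close> is a limit of polyball elements, and parameters
  \<open>r > 1\<close> that an element of the polyball can be enlarged inside it.\<close>

lemma open_nhds_on_ray:
  assumes X: "X \<in> op_tuples k n" and U: "openin (op_topology k n) U" "X \<in> U"
  obtains e where "0 < e" "\<And>r. \<bar>r - 1\<bar> < e \<Longrightarrow> scaleR_tuple k n r X \<in> U"
proof -
  have "open {r. scaleR_tuple k n r X \<in> U}"
    using openin_continuous_map_preimage[OF continuous_map_scaleR_tuple[OF X] U(1)] by simp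
  moreover have "1 \<in> {r. scaleR_tuple k n r X \<in> U}" using U(2) by (simp add: scaleR_tuple_one[OF X])
  ultimately obtain e where "0 < e" "ball 1 e \<subseteq> {r. scaleR_tuple k n r X \<in> U}"
    using open_contains_ball by blast
  moreover have "r \<in> ball 1 e" if "\<bar>r - 1\<bar> < e" for r
    using that by (simp add: dist_real_def abs_minus_commute)
  ultimately show thesis by (intro that[of e]) blast+
qed

lemma closure_of_polyball:
  "op_topology k n closure_of polyball k n
    = (nonneg_defect_tuples k n :: 'h::complex_hilbert_space op_tuple set)"
proof
  show "op_topology k n closure_of polyball k n \<subseteq> nonneg_defect_tuples k n"
    by (rule closure_of_minimal[OF polyball_subset_nonneg_defect_tuples closedin_nonneg_defect_tuples])
  show "(nonneg_defect_tuples k n :: 'h op_tuple set) \<subseteq> op_topology k n closure_of polyball k n"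
  proof
    fix X :: "'h op_tuple" assume X: "X \<in> nonneg_defect_tuples k n"
    then have ops: "X \<in> op_tuples k n"
      by (simp add: nonneg_defect_tuples_def commuting_tuples_def)
    have "\<exists>Y. Y \<in> polyball k n \<and> Y \<in> U" if U: "X \<in> U" "openin (op_topology k n) U" for U
    proof -
      obtain e where e: "0 < e" "\<And>r. \<bar>r - 1\<bar> < e \<Longrightarrow> scaleR_tuple k n r X \<in> U"
        using open_nhds_on_ray[OF ops U(2,1)] by blast
      define r where "r = max (1/2) (1 - e/2)"
      have r: "0 < r" "r < 1" "\<bar>r - 1\<bar> < e" using e(1) by (auto simp: r_def max_def abs_if)
      have "scaleR_tuple k n r X \<in> polyball k n"
        unfolding scaleR_tuple_eq_scale_tuple
        using r by (intro scale_tuple_in_polyball[OF X, of r]) simp_all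
      then show ?thesis using e(2)[OF r(3)] by blast
    qed
    then show "X \<in> op_topology k n closure_of polyball k n"
      using ops by (simp add: in_closure_of)
  qed
qed

text \<open>Since the polyball is open, \<open>tX\<close> still belongs to it for some \<open>t > 1\<close>, and \<open>X = t\<^sup>-\<^sup>1(tX)\<close>.\<close>

lemma polyball_scaled_from_polyball:
  fixes X :: "'a::complex_hilbert_space op_tuple"
  assumes X: "X \<in> polyball k n"
  obtains r Y where "0 < r" "r < 1" "Y \<in> polyball k n" "X = scaleR_tuple k n r Y"
proof -
  have comm: "X \<in> commuting_tuples k n" using X by (simp add: polyball_def)
  then have ops: "X \<in> op_tuples k n" by (simp add: commuting_tuples_def)
  obtain U :: "'a op_tuple set" where U: "openin (op_topology k n) U" "polyball k n = U \<inter> commuting_tuples k n"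
    using openin_polyball[of k n] by (auto simp: openin_subtopology)
  then have "X \<in> U" using X by blast
  then obtain e where e: "0 < e" "\<And>r. \<bar>r - 1\<bar> < e \<Longrightarrow> scaleR_tuple k n r X \<in> U"
    using open_nhds_on_ray[OF ops U(1)] by blast
  define t where "t = 1 + e/2"
  have t: "1 < t" "\<bar>t - 1\<bar> < e" using e(1) by (simp_all add: t_def)
  have "scaleR_tuple k n t X \<in> polyball k n"
    unfolding U(2) using e(2)[OF t(2)] scale_tuple_in_commuting_tuples[OF comm]
    by (simp add: scaleR_tuple_eq_scale_tuple)
  moreover have "scaleR_tuple k n (1/t) (scaleR_tuple k n t X) = X"
  proof -
    have "complex_of_real (1/t) * complex_of_real t = 1" using t(1) by (simp flip: of_real_mult)
    then show ?thesis
      by (simp only: scaleR_tuple_eq_scale_tuple scale_tuple_scale_tuple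
          scale_tuple_one[OF commuting_tuples_extensional[OF comm]])
  qed
  ultimately show thesis using t(1) by (intro that[of "1/t" "scaleR_tuple k n t X"]) simp_all
qed

text \<open>Writing \<open>X = rY\<close> with \<open>r < 1\<close> and \<open>Y\<close> in the polyball turns the weight \<open>z\<close> with entries in
  the closed disc into the weight \<open>rz\<close> with entries of modulus at most \<open>r\<close>.\<close>

lemma scale_polyball:
  assumes X: "X \<in> polyball k n" and z: "\<And>ij. ij \<in> idx k n \<Longrightarrow> cmod (z ij) \<le> 1"
  shows "scale_tuple k n z X \<in> polyball k n"
proof -
  obtain r Y where r: "0 < r" "r < 1" and Y: "Y \<in> polyball k n" and XY: "X = scaleR_tuple k n r Y"
    using polyball_scaled_from_polyball[OF X] by blast
  have "scale_tuple k n (\<lambda>ij. z ij * complex_of_real r) Y \<in> polyball k n"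
  proof (rule scale_tuple_in_polyball[OF _ r])
    show "Y \<in> nonneg_defect_tuples k n" using Y polyball_subset_nonneg_defect_tuples by blast
    show "cmod (z ij * complex_of_real r) \<le> r" if "ij \<in> idx k n" for ij
      using mult_right_mono[OF z[OF that], of r] r by (simp add: norm_mult)
  qed
  then show ?thesis by (simp add: XY scaleR_tuple_eq_scale_tuple scale_tuple_scale_tuple)
qed

lemma zero_tuple_in_polyball:
  "(\<lambda>_\<in>idx k n. 0) \<in> (polyball k n :: 'h::complex_hilbert_space op_tuple set)"
proof -
  let ?Z = "(\<lambda>_\<in>idx k n. 0) :: 'h op_tuple"
  have comm: "?Z \<in> commuting_tuples k n"
    by (auto simp: commuting_tuples_def op_tuples_def idx_def)
  have Phi0: "Phi n ?Z i Y = 0" if "i < k" for i Y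
    using that by (simp add: Phi_def idx_def)
  have defect: "partial_defect n ?Z S = id_blinfun" if "S \<subseteq> {..<k}" for S
    using finite_subset[OF that finite_lessThan] that
    by (induction S rule: finite_induct) (simp_all add: partial_defect_insert[OF comm] Phi0)
  have "coercive_op (id_blinfun :: 'h \<Rightarrow>\<^sub>L 'h)"
    unfolding coercive_op_def by (intro exI[of _ 1]) (simp add: power2_norm_eq_inner)
  then show ?thesis using comm by (simp add: polyball_eq Phi0 defect)
qed

text \<open>The polyball is the union of the segments from the zero tuple to its elements.\<close>

lemma connectedin_polyball: "connectedin (op_topology k n) (polyball k n)"
proof -
  define \<U> where "\<U> = (\<lambda>X. (\<lambda>r. scaleR_tuple k n r X) ` {0..1}) ` (polyball k n :: 'a op_tuple set)"
  have ops: "X \<in> op_tuples k n" if "X \<in> polyball k n" for X :: "'a op_tuple"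
    using that by (simp add: polyball_def commuting_tuples_def)
  have "connectedin (op_topology k n) (\<Union>\<U>)"
  proof (rule connectedin_Union)
    show "connectedin (op_topology k n) A" if "A \<in> \<U>" for A
      using that ops unfolding \<U>_def
      by (auto intro!: connectedin_continuous_map_image[OF continuous_map_scaleR_tuple])
    have "(\<lambda>_\<in>idx k n. 0) \<in> \<Inter>\<U>"
      unfolding \<U>_def by (auto intro!: image_eqI[of _ _ 0] simp: scaleR_tuple_def)
    then show "\<Inter>\<U> \<noteq> {}" by blast
  qed
  also have "\<Union>\<U> = polyball k n"
  proof
    show "\<Union>\<U> \<subseteq> polyball k n"
      unfolding \<U>_def by (auto simp: scaleR_tuple_eq_scale_tuple intro!: scale_polyball)
    have "X \<in> (\<lambda>r. scaleR_tuple k n r X) ` {0..1}" if "X \<in> polyball k n" for X :: "'a op_tuple"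
      using scaleR_tuple_one[OF ops[OF that]] by (intro image_eqI[of _ _ 1]) simp_all
    then show "polyball k n \<subseteq> \<Union>\<U>" unfolding \<U>_def by blast
  qed
  finally show ?thesis .
qed

lemma polydisc_radius:
  assumes "z \<in> polydisc k n"
  obtains s where "0 < s" "s < 1" "\<And>ij. ij \<in> idx k n \<Longrightarrow> cmod (z ij) \<le> s"
proof -
  have "finite (idx k n)" by (simp add: idx_def)
  \<comment> \<open>The element 1/2 keeps the maximum positive and defined, whatever the index set and \<open>z\<close> are.\<close>
  then have fin: "finite (insert (1/2) ((\<lambda>ij. cmod (z ij)) ` idx k n))" (is "finite ?A") by simp
  have less: "a < 1" if "a \<in> ?A" for a using that assms by (auto simp: polydisc_def)
  have "1/2 \<le> Max ?A" by (rule Max_ge[OF fin]) simp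
  moreover have "Max ?A < 1" by (rule less, rule Max_in[OF fin]) simp
  moreover have "cmod (z ij) \<le> Max ?A" if "ij \<in> idx k n" for ij
    by (rule Max_ge[OF fin]) (use that in simp)
  ultimately show thesis by (intro that[of "Max ?A"]) auto
qed

theorem proposition1p3:
  fixes k :: nat and n :: "nat \<Rightarrow> nat"
  assumes "k \<ge> 1" and "\<forall>i<k. n i \<ge> 1"
  shows "let B = (polyball k n :: 'h::complex_hilbert_space op_tuple set);
             Bc = op_topology k n closure_of B
         in
      (openin (subtopology (op_topology k n) (commuting_tuples k n)) B \<and>
       Bc = {X \<in> commuting_tuples k n.
               \<forall>p. (\<forall>i<k. p i \<in> {0, 1}) \<longrightarrow> nonneg_op (defect_map_pow k n p X id_blinfun)})
    \<and> (complete_reinhardt_domain k n B \<and>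
       B = (\<Union>z\<in>closed_polydisc k n. scale_tuple k n z ` B) \<and>
       B = (\<Union>z\<in>polydisc k n. scale_tuple k n z ` Bc) \<and>
       B = (\<Union>z\<in>polydisc k n. scale_tuple k n z ` B) \<and>
       B = (\<Union>r\<in>{0..<1}. scaleR_tuple k n r ` B) \<and>
       B = (\<Union>r\<in>{0..<1}. scaleR_tuple k n r ` Bc))
    \<and> (complete_reinhardt_set k n Bc \<and>
       Bc = (\<Union>z\<in>closed_polydisc k n. scale_tuple k n z ` Bc) \<and>
       Bc = (\<Union>r\<in>{0..1}. scaleR_tuple k n r ` Bc))"
proof -
  define B where "B = (polyball k n :: 'h op_tuple set)"
  define C where "C = (nonneg_defect_tuples k n :: 'h op_tuple set)"
  have BC: "B \<subseteq> C" unfolding B_def C_def by (rule polyball_subset_nonneg_defect_tuples)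
  have C_ops: "C \<subseteq> op_tuples k n"
    by (auto simp: C_def nonneg_defect_tuples_def commuting_tuples_def)
  have cpd: "cmod (z ij) \<le> 1" if "z \<in> closed_polydisc k n" "ij \<in> idx k n" for z ij
    using that by (auto simp: closed_polydisc_def)
  have B_closed: "scale_tuple k n z X \<in> B" if "z \<in> closed_polydisc k n" "X \<in> B" for z X
    using that cpd unfolding B_def by (intro scale_polyball) auto
  have C_closed: "scale_tuple k n z X \<in> C" if "z \<in> closed_polydisc k n" "X \<in> C" for z X
    using that cpd unfolding C_def by (intro scale_all_blocks(1)[where q = 1]) (auto simp: power_le_one)
  have C_open: "scale_tuple k n z X \<in> B" if z: "z \<in> polydisc k n" and X: "X \<in> C" for z X
  proof -
    obtain s where "0 < s" "s < 1" "\<And>ij. ij \<in> idx k n \<Longrightarrow> cmod (z ij) \<le> s"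
      using polydisc_radius[OF z] by blast
    with X show ?thesis unfolding B_def C_def by (rule scale_tuple_in_polyball)
  qed
  \<comment> \<open>Real scalars are the constant points of the polydisc.\<close>
  define c where "c r = (\<lambda>_\<in>idx k n. complex_of_real r)" for r
  have c_scale: "scaleR_tuple k n r X = scale_tuple k n (c r) X" for r and X :: "'h op_tuple"
    unfolding scaleR_tuple_eq_scale_tuple by (rule scale_tuple_cong) (simp add: c_def)
  have c_open: "c r \<in> polydisc k n" if "0 \<le> r" "r < 1" for r
    using that by (auto simp: c_def polydisc_def)
  have c_closed: "c r \<in> closed_polydisc k n" if "0 \<le> r" "r \<le> 1" for r
    using that by (auto simp: c_def closed_polydisc_def)
  have one: "X = scale_tuple k n (c 1) X" if "X \<in> C" for X
    using scaleR_tuple_one[of X k n] C_ops that unfolding c_scale by auto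
  have shrink: "\<exists>r\<in>{0..<1}. \<exists>Y\<in>B. X = scaleR_tuple k n r Y" if X: "X \<in> B" for X
  proof -
    obtain r Y where "0 < r" "r < 1" "Y \<in> B" "X = scaleR_tuple k n r Y"
      using polyball_scaled_from_polyball X unfolding B_def by blast
    then show ?thesis by (intro bexI[of _ r] bexI[of _ Y]) simp_all
  qed
  have closure: "op_topology k n closure_of B = C"
    unfolding B_def C_def by (rule closure_of_polyball)
  have open_B: "openin (subtopology (op_topology k n) (commuting_tuples k n)) B"
    unfolding B_def by (rule openin_polyball)
  have reinhardt: "complete_reinhardt_set k n B" "complete_reinhardt_set k n C"
    unfolding complete_reinhardt_set_def using BC C_ops B_closed C_closed by auto
  have "complete_reinhardt_domain k n B"
    unfolding complete_reinhardt_domain_def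
    using reinhardt(1) open_B zero_tuple_in_polyball connectedin_polyball unfolding B_def by blast
  moreover have "B = (\<Union>z\<in>closed_polydisc k n. scale_tuple k n z ` B)"
  proof (intro equalityI subsetI)
    fix X assume "X \<in> B"
    then show "X \<in> (\<Union>z\<in>closed_polydisc k n. scale_tuple k n z ` B)"
      using one BC by (intro UN_I[of "c 1"] image_eqI[of _ _ X] c_closed) auto
  qed (use B_closed in blast)
  moreover have "B = (\<Union>z\<in>polydisc k n. scale_tuple k n z ` C)"
      "B = (\<Union>z\<in>polydisc k n. scale_tuple k n z ` B)"
      "B = (\<Union>r\<in>{0..<1}. scaleR_tuple k n r ` B)"
      "B = (\<Union>r\<in>{0..<1}. scaleR_tuple k n r ` C)"
  proof -
    let ?zB = "\<Union>z\<in>polydisc k n. scale_tuple k n z ` B" and ?zC = "\<Union>z\<in>polydisc k n. scale_tuple k n z ` C"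
    let ?rB = "\<Union>r\<in>{0..<1}. scaleR_tuple k n r ` B" and ?rC = "\<Union>r\<in>{0..<1}. scaleR_tuple k n r ` C"
    have into: "?zC \<subseteq> B" using C_open by blast
    have from_B: "B \<subseteq> ?rB" using shrink by blast
    have r_z: "(\<Union>r\<in>{0..<1}. scaleR_tuple k n r ` A) \<subseteq> (\<Union>z\<in>polydisc k n. scale_tuple k n z ` A)"
      for A :: "'h op_tuple set"
    proof (rule UN_least)
      fix r :: real assume "r \<in> {0..<1}"
      then have "c r \<in> polydisc k n" by (intro c_open) simp_all
      then show "scaleR_tuple k n r ` A \<subseteq> (\<Union>z\<in>polydisc k n. scale_tuple k n z ` A)"
        unfolding c_scale by blast
    qed
    have zBC: "?zB \<subseteq> ?zC" and rBC: "?rB \<subseteq> ?rC" using BC by blast+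
    have 1: "?rB \<subseteq> ?zB" and 2: "?rC \<subseteq> ?zC" by (rule r_z)+
    show "B = ?zC" by (intro equalityI into order_trans[OF from_B order_trans[OF 1 zBC]])
    show "B = ?zB" by (intro equalityI order_trans[OF zBC into] order_trans[OF from_B 1])
    show "B = ?rB" by (intro equalityI from_B order_trans[OF 1 order_trans[OF zBC into]])
    show "B = ?rC" by (intro equalityI order_trans[OF from_B rBC] order_trans[OF 2 into])
  qed
  moreover have "C = (\<Union>z\<in>closed_polydisc k n. scale_tuple k n z ` C)"
      "C = (\<Union>r\<in>{0..1}. scaleR_tuple k n r ` C)"
  proof -
    let ?zC = "\<Union>z\<in>closed_polydisc k n. scale_tuple k n z ` C" and ?rC = "\<Union>r\<in>{0..1}. scaleR_tuple k n r ` C"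
    have into: "?zC \<subseteq> C" using C_closed by blast
    have r_z: "?rC \<subseteq> ?zC"
    proof (rule UN_least)
      fix r :: real assume "r \<in> {0..1}"
      then have "c r \<in> closed_polydisc k n" by (intro c_closed) simp_all
      then show "scaleR_tuple k n r ` C \<subseteq> ?zC" unfolding c_scale by blast
    qed
    have from_C: "C \<subseteq> ?rC"
    proof
      fix X assume "X \<in> C"
      then show "X \<in> ?rC"
        unfolding c_scale using one by (intro UN_I[of 1] image_eqI[of _ _ X]) auto
    qed
    show "C = ?zC" by (intro equalityI into order_trans[OF from_C r_z])
    show "C = ?rC" by (intro equalityI from_C order_trans[OF r_z into])
  qed
  moreover have "C = {X \<in> commuting_tuples k n.
      \<forall>p. (\<forall>i<k. p i \<in> {0, 1}) \<longrightarrow> nonneg_op (defect_map_pow k n p X id_blinfun)}"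
    unfolding C_def by (rule nonneg_defect_tuples_eq)
  ultimately show ?thesis
    unfolding Let_def B_def[symmetric] closure
    using open_B reinhardt(2) by (intro conjI)
qed

end
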